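(* Assume $\operatorname{rk}L=2$, $\omega$ is non-degenerate, and let $V=(v_1,\dots,v_n)\in L^n$ be an exchange collection consisting of primitive vectors. For every $1\le i\le n$, $$\mathcal U(V)=\mu_{v_i}^*\bigl(\mathcal U(\mu_iV)\bigr)$$ as subalgebras of $\mathbb K_L$. Consequently, for any sequence of directions $i_1,\dots,i_s$, setting $V^{(0)}=V$ and $V^{(t)}=\mu_{i_t}V^{(t-1)}$ (with $V^{(t-1)}=(v^{(t-1)}_1,\dots,v^{(t-1)}_n)$), one has $$\mathcal U(V)=\mu^*_{v^{(0)}_{i_1}}\mu^*_{v^{(1)}_{i_2}}\cdots\mu^*_{v^{(s-1)}_{i_s}}\bigl(\mathcal U(V^{(s)})\bigr).$$
   Context: Let $L\cong\mathbb Z^r$ be a lattice, $L^*=\mathrm{Hom}(L,\mathbb Z)$, $(\cdot,\cdot):L^*\times L\to\mathbb Z$ the canonical pairing, and $\omega:L\times L\to\mathbb Z$ a skew-symmetric bilinear form. Let $\mathcal Q=\mathbb Q(e^{2\pi i\mathbb Q})$ be $\mathbb Q$ with all roots of unity adjoined, $\mathcal Q[L^*]$ the group algebra of $L^*$ (Laurent polynomials) with monomials $X^m$ ($m\in L^*$), and $\mathbb K_L$ its fraction field. For $v\in L$ let $\mu_v^*$ be the $\mathcal Q$-algebra automorphism of $\mathbb K_L$ given by $\mu_v^*(X^m)=X^m\,(1+X^{\omega(\cdot,v)})^{-(m,v)}$, where $\omega(\cdot,v)\in L^*$ is $w\mapsto\omega(w,v)$. (In rank 2, with basis $e_1,e_2$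 of $L$, dual basis $f_1,f_2$, $x_i=X^{f_i}$, $k=\omega(e_1,e_2)$: $\mu_{e_2}^*(x_1,x_2)=(x_1,\,x_2/(1+x_1^k))$ and $\mu_{e_1}^*(x_1,x_2)=(x_1/(1+x_2^{-k}),\,x_2)$.) An exchange collection is an $n$-tuple $V=(v_1,\dots,v_n)\in L^n$ (repetitions allowed), with multiplicity function $m_V(v)=\#\{i: v_i=v\}$. The upper bound of $V$ is the $\mathcal Q$-subalgebra $\mathcal U(V)=\mathcal U(L,\omega;V)=\mathcal Q[L^*]\cap\bigcap_{v\in L}(\mu_v^* )^{m_V(v)}\bigl(\mathcal Q[L^*]\bigr)\subset\mathbb K_L$. The mutation of $V$ in direction $j$ is $\mu_jV=(v_1',\dots,v_n')$ with $v_j'=-v_j$ and $v_i'=v_i+\max(0,\omega(v_j,v_i))\,v_j$ for $i\ne j$. A vector of $L$ is primitive if it is nonzero and not a multiple $kw$ with $k>1$, $w\in L$. *)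

theory Defs
  imports Complex_Main "HOL-Computational_Algebra.Polynomial" "HOL-Computational_Algebra.Fraction_Field" "HOL-Library.Product_Plus"
begin

inductive_set cyclo_field :: "complex set" where
  rat: "of_rat r \<in> cyclo_field"
| root: "exp (2 * of_real pi * \<i> * of_real (of_rat q)) \<in> cyclo_field"
| add: "a \<in> cyclo_field \<Longrightarrow> b \<in> cyclo_field \<Longrightarrow> a + b \<in> cyclo_field"
| mult: "a \<in> cyclo_field \<Longrightarrow> b \<in> cyclo_field \<Longrightarrow> a * b \<in> cyclo_field"
| neg: "a \<in> cyclo_field \<Longrightarrow> - a \<in> cyclo_field"
| inv: "a \<in> cyclo_field \<Longrightarrow> inverse a \<in> cyclo_field"

text \<open>L = Z^2 with basis e1, e2; L* = Z^2 with dual basis f1, f2.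
  Rational functions in x1 = X^f1, x2 = X^f2 are realised in the fraction field of
  complex[x1][x2]; the field K_L (over the cyclotomic field) is a subfield of it.\<close>

type_synonym K = "complex poly poly fract"

definition const :: "complex \<Rightarrow> K" where
  "const c = Fract [:[:c:]:] 1"

definition x1 :: K where "x1 = Fract [:[:0, 1:]:] 1"
definition x2 :: K where "x2 = Fract [:0, 1:] 1"

definition X :: "int \<times> int \<Rightarrow> K" where
  "X m = x1 powi (fst m) * x2 powi (snd m)"

definition laurent :: "K set" where
  "laurent = {f. \<exists>c :: int \<times> int \<Rightarrow> complex. finite {m. c m \<noteq> 0} \<and> (\<forall>m. c m \<in> cyclo_field)
                \<and> f = (\<Sum>m\<in>{m. c m \<noteq> 0}. const (c m) * X m)}"

definition pair :: "int \<times> int \<Rightarrow> int \<times> int \<Rightarrow> int" where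
  "pair m v = fst m * fst v + snd m * snd v"

definition omega_dual :: "(int \<times> int \<Rightarrow> int \<times> int \<Rightarrow> int) \<Rightarrow> int \<times> int \<Rightarrow> int \<times> int" where
  "omega_dual \<omega> v = (\<omega> (1, 0) v, \<omega> (0, 1) v)"

definition eval2 :: "complex poly poly \<Rightarrow> K \<Rightarrow> K \<Rightarrow> K" where
  "eval2 p a b = poly (map_poly (\<lambda>q. poly (map_poly const q) a) p) b"

text \<open>The automorphism mu_v^*: X^m \<mapsto> X^m (1 + X^{omega(.,v)})^{-(m,v)},
  i.e. the substitution x1 \<mapsto> x1 (1+X^w)^{-(f1,v)}, x2 \<mapsto> x2 (1+X^w)^{-(f2,v)}
  applied to a representation p/q of an element.\<close>
definition mu_star :: "(int \<times> int \<Rightarrow> int \<times> int \<Rightarrow> int) \<Rightarrow> int \<times> int \<Rightarrow> K \<Rightarrow> K" where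
  "mu_star \<omega> v f =
     (let w = omega_dual \<omega> v;
          a = x1 * (1 + X w) powi (- pair (1, 0) v);
          b = x2 * (1 + X w) powi (- pair (0, 1) v);
          (p, q) = (SOME (p, q). q \<noteq> 0 \<and> f = Fract p q)
      in eval2 p a b / eval2 q a b)"

definition smul :: "int \<Rightarrow> int \<times> int \<Rightarrow> int \<times> int" where
  "smul k v = (k * fst v, k * snd v)"

definition mult_fun :: "(int \<times> int) list \<Rightarrow> int \<times> int \<Rightarrow> nat" where
  "mult_fun V v = length (filter (\<lambda>u. u = v) V)"

definition upper_bound :: "(int \<times> int \<Rightarrow> int \<times> int \<Rightarrow> int) \<Rightarrow> (int \<times> int) list \<Rightarrow> K set" where
  "upper_bound \<omega> V = laurent \<inter> (\<Inter>v. ((mu_star \<omega> v) ^^ (mult_fun V v)) ` laurent)"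

definition mutate :: "(int \<times> int \<Rightarrow> int \<times> int \<Rightarrow> int) \<Rightarrow> (int \<times> int) list \<Rightarrow> nat \<Rightarrow> (int \<times> int) list" where
  "mutate \<omega> V j = map (\<lambda>i. if i = j then - (V ! j)
                            else V ! i + smul (max 0 (\<omega> (V ! j) (V ! i))) (V ! j)) [0..<length V]"

fun mutate_seq :: "(int \<times> int \<Rightarrow> int \<times> int \<Rightarrow> int) \<Rightarrow> (int \<times> int) list \<Rightarrow> nat list \<Rightarrow> (int \<times> int) list" where
  "mutate_seq \<omega> V [] = V"
| "mutate_seq \<omega> V (i # is) = mutate_seq \<omega> (mutate \<omega> V i) is"

fun mu_seq :: "(int \<times> int \<Rightarrow> int \<times> int \<Rightarrow> int) \<Rightarrow> (int \<times> int) list \<Rightarrow> nat list \<Rightarrow> K \<Rightarrow> K" where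
  "mu_seq \<omega> V [] = id"
| "mu_seq \<omega> V (i # is) = mu_star \<omega> (V ! i) \<circ> mu_seq \<omega> (mutate \<omega> V i) is"

definition primitive :: "int \<times> int \<Rightarrow> bool" where
  "primitive v \<longleftrightarrow> v \<noteq> 0 \<and> \<not> (\<exists>k w. k > (1::int) \<and> v = smul k w)"

end

theory Submission
  imports Defs
begin

text \<open>
  Write \<open>twist d u\<close> for the automorphism \<open>X\<^sup>p \<mapsto> X\<^sup>p (1 + X\<^sup>d)\<^bsup>(p,u)\<^esup>\<close> with \<open>(d,u) = 0\<close>, so that
  the powers of the mutation in direction \<open>v\<close> are \<open>twist (\<omega>(\<cdot>,v)) (-n v)\<close> and membership in the
  upper bound means that certain twists of \<open>f\<close> are Laurent polynomials.  Grading by \<open>(\<cdot>,u)\<close> shows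
  that \<open>f\<close> and \<open>twist d u f\<close> are both Laurent iff the part of \<open>f\<close> in negative degrees consists of
  multiples of \<open>(1 + X\<^sup>d)\<^bsup>-(p,u)\<^esup> X\<^sup>p\<close>; this settles the vectors \<open>\<plusminus>v\<close>.
  For \<open>u\<close> independent of \<open>v\<close>, let \<open>J'\<close> be the ring of Laurent polynomials that stay Laurent after the
  twist belonging to the mutated vector \<open>u'\<close>.  Up to a sign choice \<open>\<delta> = \<plusminus>\<omega>(\<cdot>,v)\<close> and a
  monomial change of coordinates, the mutation in direction \<open>v\<close> only multiplies monomials by powers of
  \<open>D = 1 + X\<^sup>\<delta>\<close> where \<open>(\<delta>,u') > 0\<close>.  It sends the generators of the ring for \<open>u\<close> into \<open>J'\<close> up to
  powers of \<open>D\<close>, and \<open>D\<close> can be cancelled: \<open>X\<^sup>\<delta>\<close> has positive degree, so \<open>X\<^bsup>n\<delta>\<^esup> h \<in> J'\<close> for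
  large \<open>n\<close>, and \<open>X\<^bsup>n\<delta>\<^esup> h = X\<^bsup>n\<delta>\<^esup> (D h) - X\<^bsup>(n+1)\<delta>\<^esup> h\<close> lowers \<open>n\<close>.
\<close>

section \<open>Monomials and evaluation of polynomials\<close>

lemma const_add: "const (a + b) = const a + const b"
  by (simp add: const_def)

lemma const_mult: "const (a * b) = const a * const b"
  by (simp add: const_def)

lemma const_0 [simp]: "const 0 = 0"
  by (simp add: const_def Zero_fract_def)

lemma const_1 [simp]: "const 1 = 1"
  by (simp add: const_def One_fract_def flip: one_pCons)

lemma x1_neq_0 [simp]: "x1 \<noteq> 0" and x2_neq_0 [simp]: "x2 \<noteq> 0"
  by (simp_all add: x1_def x2_def Zero_fract_def eq_fract)

lemma X_0 [simp]: "X 0 = 1"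
  by (simp add: X_def)

lemma X_neq_0 [simp]: "X m \<noteq> 0"
  by (simp add: X_def)

lemma X_add: "X (m + n) = X m * X n"
  by (simp add: X_def power_int_add)

lemma X_minus: "X (- m) = inverse (X m)"
  by (simp add: X_def power_int_minus)

lemma X_smul: "X (smul k m) = X m powi k"
  by (simp add: X_def smul_def power_int_mult_distrib mult.commute flip: power_int_mult)

lemma X_of_nat: "X (int i, int j) = x1 ^ i * x2 ^ j"
  by (simp add: X_def)

lemma Fract_add_1: "Fract (a + b) 1 = Fract a 1 + Fract b (1 :: 'a::idom)"
  by simp

lemma poly_map_poly_add:
  fixes h :: "'a::comm_ring_1 \<Rightarrow> 'b::comm_ring_1"
  assumes "h 0 = 0" "\<And>a b. h (a + b) = h a + h b"
  shows "poly (map_poly h (p + q)) x = poly (map_poly h p) x + poly (map_poly h q) x"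
proof -
  have "map_poly h (p + q) = map_poly h p + map_poly h q"
    by (rule poly_eqI) (simp add: coeff_map_poly assms)
  then show ?thesis by simp
qed

lemma poly_map_poly_mult:
  fixes h :: "'a::comm_ring_1 \<Rightarrow> 'b::comm_ring_1"
  assumes "h 0 = 0" "\<And>a b. h (a + b) = h a + h b" "\<And>a b. h (a * b) = h a * h b"
  shows "poly (map_poly h (p * q)) x = poly (map_poly h p) x * poly (map_poly h q) x"
proof (induction p)
  case (pCons a p)
  then show ?case
    by (simp add: poly_map_poly_add assms map_poly_pCons map_poly_smult algebra_simps)
qed (use assms in simp)

lemma eval2_const: "eval2 [:[:c:]:] a b = const c"
  by (simp add: eval2_def map_poly_pCons)

lemma eval2_add: "eval2 (p + q) a b = eval2 p a b + eval2 q a b"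
  unfolding eval2_def
  by (rule poly_map_poly_add) (simp_all add: poly_map_poly_add const_add)

lemma eval2_mult: "eval2 (p * q) a b = eval2 p a b * eval2 q a b"
  unfolding eval2_def
  by (rule poly_map_poly_mult) (simp_all add: poly_map_poly_add poly_map_poly_mult const_add const_mult)

lemma eval2_1 [simp]: "eval2 1 a b = 1"
  using eval2_const[of 1 a b] by (simp flip: one_pCons)

lemma eval2_x1: "eval2 [:[:0, 1:]:] a b = a" and eval2_x2: "eval2 [:0, 1:] a b = b"
  by (simp_all add: eval2_def map_poly_pCons)

lemma eval2_x1_x2: "eval2 p x1 x2 = Fract p 1"
proof -
  have inner: "poly (map_poly const q) x1 = Fract [:q:] 1" for q
  proof (induction q)
    case (pCons c q)
    have "poly (map_poly const (pCons c q)) x1 = const c + x1 * Fract [:q:] 1"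
      by (simp add: map_poly_pCons pCons.IH)
    also have "\<dots> = Fract [:pCons c q:] 1"
      by (simp add: const_def x1_def)
    finally show ?case .
  qed (simp add: Zero_fract_def)
  show ?thesis
    unfolding eval2_def inner
  proof (induction p)
    case (pCons q p)
    have "map_poly (\<lambda>q. Fract [:q:] 1) (pCons q p)
        = pCons (Fract [:q:] 1) (map_poly (\<lambda>q. Fract [:q:] 1) p)"
      by (rule map_poly_pCons) (simp add: Zero_fract_def)
    with pCons show ?case by (simp add: x2_def)
  qed (simp add: Zero_fract_def)
qed

lemma poly_map_poly_conv_sum:
  fixes h :: "'a::zero \<Rightarrow> 'b::comm_ring_1"
  assumes "h 0 = 0" "degree p \<le> n"
  shows "poly (map_poly h p) x = (\<Sum>i\<le>n. h (coeff p i) * x ^ i)"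
proof -
  have "poly (map_poly h p) x = (\<Sum>i\<le>degree (map_poly h p). h (coeff p i) * x ^ i)"
    by (simp add: poly_altdef coeff_map_poly assms)
  also have "\<dots> = (\<Sum>i\<le>n. h (coeff p i) * x ^ i)"
  proof (rule sum.mono_neutral_left)
    show "{..degree (map_poly h p)} \<subseteq> {..n}"
      using assms(2) map_poly_degree_leq[of h p] by auto
    show "\<forall>i\<in>{..n} - {..degree (map_poly h p)}. h (coeff p i) * x ^ i = 0"
      using coeff_eq_0[of "map_poly h p"] by (auto simp: coeff_map_poly assms)
  qed simp
  finally show ?thesis .
qed

text \<open>The bound depends on \<open>p\<close> alone and not on the point, so evaluations at
  different points expand over the same exponent box and can be compared term by term.\<close>

lemma eval2_conv_sum:
  obtains n where "\<And>a b. eval2 p a b = (\<Sum>(i, j)\<in>{..n} \<times> {..n}. const (coeff (coeff p j) i) * (a ^ i * b ^ j))"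
    and "\<And>i j. coeff (coeff p j) i \<noteq> 0 \<Longrightarrow> i \<le> n \<and> j \<le> n"
proof -
  \<comment> \<open>The sum of the inner degrees dominates each of them, so one bound serves the
    exponents of both variables.\<close>
  define n where "n = degree p + (\<Sum>j\<le>degree p. degree (coeff p j))"
  have d: "degree (coeff p j) \<le> n" for j
  proof (cases "j \<le> degree p")
    case True
    then have "degree (coeff p j) \<le> (\<Sum>j\<le>degree p. degree (coeff p j))"
      by (intro member_le_sum) auto
    then show ?thesis by (simp add: n_def)
  qed (simp add: coeff_eq_0)
  have "eval2 p a b = (\<Sum>(i, j)\<in>{..n} \<times> {..n}. const (coeff (coeff p j) i) * (a ^ i * b ^ j))" for a b
  proof -
    have "eval2 p a b = (\<Sum>j\<le>n. poly (map_poly const (coeff p j)) a * b ^ j)"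
      unfolding eval2_def by (rule poly_map_poly_conv_sum) (simp_all add: n_def)
    also have "\<dots> = (\<Sum>j\<le>n. \<Sum>i\<le>n. const (coeff (coeff p j) i) * (a ^ i * b ^ j))"
      by (simp add: poly_map_poly_conv_sum[of const, OF const_0 d] sum_distrib_right mult.assoc)
    also have "\<dots> = (\<Sum>i\<le>n. \<Sum>j\<le>n. const (coeff (coeff p j) i) * (a ^ i * b ^ j))"
      by (rule sum.swap)
    finally show ?thesis by (simp add: sum.cartesian_product)
  qed
  moreover have "i \<le> n \<and> j \<le> n" if "coeff (coeff p j) i \<noteq> 0" for i j
  proof
    show "i \<le> n" using le_degree[OF that] d[of j] by simp
    have "coeff p j \<noteq> 0" using that by auto
    then show "j \<le> n" using le_degree[of p j] by (simp add: n_def)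
  qed
  ultimately show thesis using that by blast
qed

text \<open>Multiplying by a large monomial \<open>X (int N, int N)\<close> makes all exponents
  nonnegative, and the relation becomes a polynomial \<open>p\<close> whose coefficients are the
  \<open>c m\<close>.\<close>

lemma X_sum_eq_0_imp:
  assumes "finite S" and sum0: "(\<Sum>m\<in>S. const (c m) * X m) = 0" and "m0 \<in> S"
  shows "c m0 = 0"
proof -
  obtain N :: nat where N: "\<forall>m\<in>S. - int N \<le> fst m \<and> - int N \<le> snd m"
  proof
    show "\<forall>m\<in>S. - int (\<Sum>m\<in>S. nat \<bar>fst m\<bar> + nat \<bar>snd m\<bar>) \<le> fst m \<and>
        - int (\<Sum>m\<in>S. nat \<bar>fst m\<bar> + nat \<bar>snd m\<bar>) \<le> snd m"
    proof
      fix m assume "m \<in> S"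
      then have "nat \<bar>fst m\<bar> + nat \<bar>snd m\<bar> \<le> (\<Sum>m\<in>S. nat \<bar>fst m\<bar> + nat \<bar>snd m\<bar>)"
        using \<open>finite S\<close> by (intro member_le_sum[of m S "\<lambda>m. nat \<bar>fst m\<bar> + nat \<bar>snd m\<bar>"]) auto
      then show "- int (\<Sum>m\<in>S. nat \<bar>fst m\<bar> + nat \<bar>snd m\<bar>) \<le> fst m \<and>
        - int (\<Sum>m\<in>S. nat \<bar>fst m\<bar> + nat \<bar>snd m\<bar>) \<le> snd m"
        by linarith
    qed
  qed
  define a where "a m = nat (fst m + int N)" for m :: "int \<times> int"
  define b where "b m = nat (snd m + int N)" for m :: "int \<times> int"
  define p where "p = (\<Sum>m\<in>S. monom (monom (c m) (a m)) (b m))"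
  have inj: "m = m0" if "m \<in> S" "a m = a m0" "b m = b m0" for m
  proof -
    have "fst m = fst m0" "snd m = snd m0"
      using that N \<open>m0 \<in> S\<close> unfolding a_def b_def by (smt (verit) eq_nat_nat_iff)+
    then show ?thesis by (rule prod_eqI)
  qed
  have monom: "Fract (monom (monom z i) j) 1 = const z * (x1 ^ i * x2 ^ j)" for z i j
  proof -
    have "Fract (monom (monom z i) j) 1 = eval2 (monom (monom z i) j) x1 x2"
      by (simp add: eval2_x1_x2)
    also have "\<dots> = const z * (x1 ^ i * x2 ^ j)"
      unfolding eval2_def by (subst map_poly_monom) (simp_all add: map_poly_monom poly_monom)
    finally show ?thesis .
  qed
  have "Fract p 1 = (\<Sum>m\<in>S. Fract (monom (monom (c m) (a m)) (b m)) 1)"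
    unfolding p_def using \<open>finite S\<close>
    by (induction S) (simp_all add: Zero_fract_def Fract_add_1)
  also have "\<dots> = (\<Sum>m\<in>S. const (c m) * X m * X (int N, int N))"
  proof (rule sum.cong)
    fix m assume "m \<in> S"
    then have "m + (int N, int N) = (int (a m), int (b m))"
      using N by (cases m) (auto simp: a_def b_def)
    then have "X m * X (int N, int N) = x1 ^ a m * x2 ^ b m"
      by (metis X_add X_of_nat)
    then show "Fract (monom (monom (c m) (a m)) (b m)) 1 = const (c m) * X m * X (int N, int N)"
      by (simp add: monom mult.assoc)
  qed simp
  also have "\<dots> = 0"
    using sum0 by (simp flip: sum_distrib_right)
  finally have "p = 0"
    by (simp add: Zero_fract_def eq_fract)
  then have "0 = coeff (coeff p (b m0)) (a m0)" by simp
  also have "\<dots> = (\<Sum>m\<in>S. if m = m0 then c m else 0)"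
    unfolding p_def coeff_sum by (rule sum.cong) (use inj in auto)
  also have "\<dots> = c m0"
    using assms by simp
  finally show ?thesis by simp
qed

section \<open>Spans of monomials\<close>

text \<open>Laurent polynomials are tracked over \<open>cyclo_field\<close>, whereas independence
  arguments enlarge the coefficients to \<open>UNIV\<close>.\<close>

definition coeff_ring :: "complex set \<Rightarrow> bool" where
  "coeff_ring F \<longleftrightarrow> 0 \<in> F \<and> 1 \<in> F \<and> - 1 \<in> F \<and> (\<forall>a\<in>F. \<forall>b\<in>F. a + b \<in> F \<and> a * b \<in> F)"

lemma coeff_ring_UNIV: "coeff_ring UNIV"
  by (simp add: coeff_ring_def)

lemma coeff_ring_cyclo_field: "coeff_ring cyclo_field"
  unfolding coeff_ring_def
  using cyclo_field.rat[of 0] cyclo_field.rat[of 1] cyclo_field.rat[of "-1"]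
  by (auto intro: cyclo_field.add cyclo_field.mult simp: of_rat_minus)

inductive_set lspan :: "complex set \<Rightarrow> (int \<times> int) set \<Rightarrow> K set" for F P where
  zero: "0 \<in> lspan F P"
| step: "c \<in> F \<Longrightarrow> m \<in> P \<Longrightarrow> f \<in> lspan F P \<Longrightarrow> const c * X m + f \<in> lspan F P"

lemma lspan_mono:
  assumes "f \<in> lspan F P" "F \<subseteq> F'" "P \<subseteq> P'"
  shows "f \<in> lspan F' P'"
  using assms(1) by induction (use assms(2,3) in \<open>auto intro: lspan.intros\<close>)

lemma lspan_add:
  assumes "f \<in> lspan F P" "g \<in> lspan F P"
  shows "f + g \<in> lspan F P"
  using assms(1) by induction (auto simp: add.assoc intro: lspan.step assms(2))

lemma lspan_monom: "c \<in> F \<Longrightarrow> m \<in> P \<Longrightarrow> const c * X m \<in> lspan F P"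
  using lspan.step[OF _ _ lspan.zero, of c F m P] by simp

lemma lspan_X: "coeff_ring F \<Longrightarrow> m \<in> P \<Longrightarrow> X m \<in> lspan F P"
  using lspan_monom[of 1 F m P] by (simp add: coeff_ring_def)

lemma lspan_monom_mult:
  assumes "g \<in> lspan F P'" "coeff_ring F" "c \<in> F" "\<And>n. n \<in> P' \<Longrightarrow> m + n \<in> P''"
  shows "const c * X m * g \<in> lspan F P''"
  using assms(1)
proof induction
  case (step c' m' f)
  have "const c * X m * (const c' * X m' + f) = const (c * c') * X (m + m') + const c * X m * f"
    by (simp add: const_mult X_add algebra_simps)
  then show ?case
    using step assms(2-4) by (simp add: lspan.step coeff_ring_def)
qed (simp add: lspan.zero)

lemma lspan_mult:
  assumes "f \<in> lspan F P" "g \<in> lspan F P'" "coeff_ring F"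
    and "\<And>m n. m \<in> P \<Longrightarrow> n \<in> P' \<Longrightarrow> m + n \<in> P''"
  shows "f * g \<in> lspan F P''"
  using assms(1)
proof induction
  case (step c m f)
  then show ?case
    unfolding distrib_right using assms(2-4) by (intro lspan_add lspan_monom_mult)
qed (simp add: lspan.zero)

lemma lspan_diff:
  assumes "f \<in> lspan F P" "g \<in> lspan F P" "coeff_ring F"
  shows "f - g \<in> lspan F P"
proof -
  have "const (- 1) + 1 = 0"
    using const_add[of "- 1" 1] by simp
  then have "const (- 1) = - 1"
    by (simp add: eq_neg_iff_add_eq_0)
  then have "- g \<in> lspan F P"
    using lspan_monom_mult[OF assms(2,3), of "- 1" 0 P] assms(3) by (simp add: coeff_ring_def)
  then show ?thesis
    using lspan_add[OF assms(1), of "- g"] by simp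
qed

lemma lspan_power:
  assumes "f \<in> lspan F P" "coeff_ring F" "0 \<in> P" "\<And>m n. m \<in> P \<Longrightarrow> n \<in> P \<Longrightarrow> m + n \<in> P"
  shows "f ^ n \<in> lspan F P"
proof (induction n)
  case 0
  then show ?case using lspan_X[OF assms(2,3)] by simp
next
  case (Suc n)
  then show ?case using lspan_mult[OF assms(1) Suc assms(2) assms(4)] by simp
qed

lemma lspan_sum:
  assumes "finite S" "\<And>m. m \<in> S \<Longrightarrow> f m \<in> lspan F P"
  shows "(\<Sum>m\<in>S. f m) \<in> lspan F P"
  using assms by (induction S) (auto intro: lspan.zero lspan_add)

text \<open>The inductive construction may add one exponent repeatedly. Coefficients at equal
  exponents are merged here, so that linear independence of monomials applies.\<close>

lemma lspan_conv_sum: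
  assumes "f \<in> lspan F P" "coeff_ring F"
  obtains c S where "finite S" "S \<subseteq> P" "\<And>m. c m \<in> F" "f = (\<Sum>m\<in>S. const (c m) * X m)"
proof -
  have "\<exists>c S. finite S \<and> S \<subseteq> P \<and> (\<forall>m. c m \<in> F) \<and> f = (\<Sum>m\<in>S. const (c m) * X m)"
    using assms(1)
  proof induction
    case zero
    then show ?case
      using assms(2) by (intro exI[of _ "\<lambda>_. 0"] exI[of _ "{}"]) (simp add: coeff_ring_def)
  next
    case (step a n f)
    then obtain c S where *: "finite S" "S \<subseteq> P" "\<forall>m. c m \<in> F" "f = (\<Sum>m\<in>S. const (c m) * X m)"
      by blast
    define c' where "c' = c (n := a + (if n \<in> S then c n else 0))"
    have "f = (\<Sum>m\<in>S - {n}. const (c m) * X m) + const (if n \<in> S then c n else 0) * X n"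
      using * by (auto simp: sum.remove)
    moreover have "(\<Sum>m\<in>insert n S. const (c' m) * X m)
        = const (c' n) * X n + (\<Sum>m\<in>S - {n}. const (c m) * X m)"
      using * by (auto simp: sum.insert_remove c'_def intro!: sum.cong)
    ultimately have "const a * X n + f = (\<Sum>m\<in>insert n S. const (c' m) * X m)"
      by (simp add: c'_def const_add algebra_simps)
    moreover have "\<forall>m. c' m \<in> F"
      using * step assms(2) by (auto simp: c'_def coeff_ring_def)
    ultimately show ?case
      using * step by (intro exI[of _ c'] exI[of _ "insert n S"]) auto
  qed
  then show thesis using that by blast
qed

lemma laurent_eq_lspan: "laurent = lspan cyclo_field UNIV"
proof (intro equalityI subsetI)
  fix f assume "f \<in> laurent"
  then show "f \<in> lspan cyclo_field UNIV"
    unfolding laurent_def by (auto intro!: lspan_sum lspan_monom)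
next
  fix f assume "f \<in> lspan cyclo_field UNIV"
  then obtain c S where *: "finite S" "S \<subseteq> UNIV" "\<And>m. c m \<in> cyclo_field" "f = (\<Sum>m\<in>S. const (c m) * X m)"
    using coeff_ring_cyclo_field by (rule lspan_conv_sum) blast
  define c' where "c' m = (if m \<in> S then c m else 0)" for m
  have "{m. c' m \<noteq> 0} \<subseteq> S"
    by (auto simp: c'_def)
  moreover have "f = (\<Sum>m\<in>{m. c' m \<noteq> 0}. const (c' m) * X m)"
    unfolding * by (rule sum.mono_neutral_cong_right) (use * in \<open>auto simp: c'_def split: if_splits\<close>)
  moreover have "c' m \<in> cyclo_field" for m
    using * coeff_ring_cyclo_field by (simp add: c'_def coeff_ring_def)
  ultimately show "f \<in> laurent"
    unfolding laurent_def using * finite_subset by blast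
qed

lemma lspan_split:
  assumes "f \<in> lspan F P"
  obtains g h where "g \<in> lspan F (P \<inter> R)" "h \<in> lspan F (P - R)" "f = g + h"
proof -
  have "\<exists>g\<in>lspan F (P \<inter> R). \<exists>h\<in>lspan F (P - R). f = g + h"
    using assms
  proof induction
    case zero
    show ?case by (auto intro!: bexI[OF _ lspan.zero])
  next
    case (step c m f)
    then obtain g h where gh: "g \<in> lspan F (P \<inter> R)" "h \<in> lspan F (P - R)" "f = g + h"
      by blast
    show ?case
    proof (cases "m \<in> R")
      case True
      then have "const c * X m + g \<in> lspan F (P \<inter> R)"
        using step gh by (auto intro: lspan.step)
      then show ?thesis
        using gh(2) unfolding gh(3) by (metis add.assoc)
    next
      case False
      then have "const c * X m + h \<in> lspan F (P - R)"
        using step gh by (auto intro: lspan.step)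
      then show ?thesis
        using gh(1) unfolding gh(3) by (metis add.left_commute)
    qed
  qed
  then show thesis using that by blast
qed

text \<open>Over the coefficients \<open>UNIV\<close>, \<open>f\<close> and \<open>0 - f\<close> add
  up to a relation between monomials with distinct exponents, so the coefficients of
  \<open>f\<close> vanish.\<close>

lemma lspan_disjoint:
  assumes "f \<in> lspan F P" "f \<in> lspan F' P'" "P \<inter> P' = {}"
  shows "f = 0"
proof -
  obtain c S where S: "finite S" "S \<subseteq> P" "\<And>m. c m \<in> UNIV" "f = (\<Sum>m\<in>S. const (c m) * X m)"
    using lspan_mono[OF assms(1) subset_UNIV order_refl] coeff_ring_UNIV by (rule lspan_conv_sum) blast
  have "0 - f \<in> lspan UNIV P'"
    by (intro lspan_diff lspan.zero coeff_ring_UNIV lspan_mono[OF assms(2)]) auto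
  then obtain c' S' where S': "finite S'" "S' \<subseteq> P'" "\<And>m. c' m \<in> UNIV" "0 - f = (\<Sum>m\<in>S'. const (c' m) * X m)"
    using coeff_ring_UNIV by (rule lspan_conv_sum) blast
  define e where "e m = (if m \<in> S then c m else c' m)" for m
  have disj: "S \<inter> S' = {}"
    using S S' assms(3) by auto
  have "(\<Sum>m\<in>S. const (e m) * X m) = f"
    unfolding S(4) by (rule sum.cong) (auto simp: e_def)
  moreover have "(\<Sum>m\<in>S'. const (e m) * X m) = 0 - f"
    unfolding S'(4) by (rule sum.cong) (use disj in \<open>auto simp: e_def\<close>)
  ultimately have "(\<Sum>m\<in>S \<union> S'. const (e m) * X m) = 0"
    using S(1) S'(1) disj by (simp add: sum.union_disjoint)
  then have "e m = 0" if "m \<in> S" for m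
    using X_sum_eq_0_imp[of "S \<union> S'" e m] S S' that by simp
  then have "(\<Sum>m\<in>S. const (e m) * X m) = 0"
    by simp
  then show ?thesis
    using \<open>(\<Sum>m\<in>S. const (e m) * X m) = f\<close> by simp
qed

text \<open>Otherwise the monomial \<open>X 0\<close> would be a multiple of the different monomial
  \<open>X d\<close>.\<close>

lemma one_plus_X_neq_0:
  assumes "d \<noteq> 0"
  shows "1 + X d \<noteq> 0"
proof
  assume "1 + X d = 0"
  then have "X 0 = 0 - X d"
    by (simp add: eq_neg_iff_add_eq_0)
  then have "X 0 \<in> lspan UNIV {d}"
    by (simp only:) (intro lspan_diff lspan.zero lspan_X coeff_ring_UNIV, simp)
  moreover have "X 0 \<in> lspan UNIV {0}"
    by (rule lspan_X[OF coeff_ring_UNIV]) simp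
  ultimately show False
    using lspan_disjoint[of "X 0" UNIV "{d}" UNIV "{0}"] assms X_neq_0 by auto
qed

section \<open>Field endomorphisms given by substitution\<close>

locale K_hom =
  fixes \<phi> :: "K \<Rightarrow> K"
  assumes add: "\<phi> (a + b) = \<phi> a + \<phi> b"
    and mult: "\<phi> (a * b) = \<phi> a * \<phi> b"
    and const: "\<phi> (const c) = const c"
begin

lemma one [simp]: "\<phi> 1 = 1"
  using const[of 1] by simp

lemma zero [simp]: "\<phi> 0 = 0"
  using const[of 0] by simp

lemma inverse: "\<phi> (inverse a) = inverse (\<phi> a)"
proof (cases "a = 0")
  case False
  then have "\<phi> a * \<phi> (inverse a) = 1"
    by (simp flip: mult)
  then show ?thesis by (simp add: inverse_unique)
qed simp

lemma divide: "\<phi> (a / b) = \<phi> a / \<phi> b"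
  by (simp add: divide_inverse mult inverse)

lemma power: "\<phi> (a ^ n) = \<phi> a ^ n"
  by (induction n) (simp_all add: mult)

lemma powi: "\<phi> (a powi k) = \<phi> a powi k"
  by (simp add: power_int_def power inverse)

lemma sum: "\<phi> (\<Sum>i\<in>S. f i) = (\<Sum>i\<in>S. \<phi> (f i))"
  by (induction S rule: infinite_finite_induct) (simp_all add: add)

text \<open>Every element is a quotient of polynomials in \<open>x1\<close> and \<open>x2\<close>,
  so a homomorphism fixing constants is determined by its values there. Identities between twists
  are therefore checked on these two generators.\<close>

lemma Fract_conv_eval2: "\<phi> (Fract p q) = eval2 p (\<phi> x1) (\<phi> x2) / eval2 q (\<phi> x1) (\<phi> x2)"
proof -
  have "\<phi> (eval2 p x1 x2) = eval2 p (\<phi> x1) (\<phi> x2)" for p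
  proof -
    obtain n where n: "\<And>a b. eval2 p a b
        = (\<Sum>(i, j)\<in>{..n} \<times> {..n}. const (coeff (coeff p j) i) * (a ^ i * b ^ j))"
      and "\<And>i j. coeff (coeff p j) i \<noteq> 0 \<Longrightarrow> i \<le> n \<and> j \<le> n"
      by (rule eval2_conv_sum[of p]) blast
    show ?thesis
      by (simp add: n sum case_prod_unfold mult power const)
  qed
  moreover have "Fract p q = eval2 p x1 x2 / eval2 q x1 x2"
    by (simp add: eval2_x1_x2)
  ultimately show ?thesis
    by (simp add: divide)
qed

end

lemma K_hom_eqI:
  assumes "K_hom \<phi>" "K_hom \<psi>" "\<phi> x1 = \<psi> x1" "\<phi> x2 = \<psi> x2"
  shows "\<phi> f = \<psi> f"
  by (cases f) (simp add: K_hom.Fract_conv_eval2[OF assms(1)] K_hom.Fract_conv_eval2[OF assms(2)] assms)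

lemma K_hom_id: "K_hom (\<lambda>f. f)"
  by unfold_locales simp_all

lemma K_hom_comp:
  assumes "K_hom \<phi>" "K_hom \<psi>"
  shows "K_hom (\<lambda>f. \<phi> (\<psi> f))"
proof -
  interpret a: K_hom \<phi> by fact
  interpret b: K_hom \<psi> by fact
  show ?thesis by unfold_locales (simp_all add: a.add b.add a.mult b.mult a.const b.const)
qed

text \<open>The substitution underlying \<open>mu_star\<close>, computed on an arbitrarily chosen
  fraction. It is a homomorphism once \<open>a\<close> and \<open>b\<close> are algebraically
  independent.\<close>

definition subst :: "K \<Rightarrow> K \<Rightarrow> K \<Rightarrow> K" where
  "subst a b f = (let (p, q) = (SOME (p, q). q \<noteq> 0 \<and> f = Fract p q) in eval2 p a b / eval2 q a b)"

locale alg_independent =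
  fixes a b :: K
  assumes eval2_neq_0: "q \<noteq> 0 \<Longrightarrow> eval2 q a b \<noteq> 0"
begin

text \<open>Two fractions for one element satisfy \<open>p * q' = p' * q\<close>. This survives
  evaluation, and independence keeps both denominators nonzero, so the choice does not affect the
  value.\<close>

lemma subst_Fract:
  assumes "q \<noteq> 0"
  shows "subst a b (Fract p q) = eval2 p a b / eval2 q a b"
proof -
  define r where "r = (SOME (p', q'). q' \<noteq> 0 \<and> Fract p q = Fract p' q')"
  have "case r of (p', q') \<Rightarrow> q' \<noteq> 0 \<and> Fract p q = Fract p' q'"
    unfolding r_def by (rule someI[of _ "(p, q)"]) (use assms in simp)
  then obtain p' q' where r: "r = (p', q')" "q' \<noteq> 0" "Fract p q = Fract p' q'"
    by (cases r) auto
  then have "p * q' = p' * q"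
    using assms by (simp add: eq_fract)
  then have "eval2 p a b * eval2 q' a b = eval2 p' a b * eval2 q a b"
    by (metis eval2_mult)
  moreover have "subst a b (Fract p q) = eval2 p' a b / eval2 q' a b"
    unfolding subst_def r_def[symmetric] by (simp add: r)
  ultimately show ?thesis
    using eval2_neq_0 assms r by (simp add: frac_eq_eq)
qed

lemma K_hom_subst: "K_hom (subst a b)"
proof
  fix f g :: K
  obtain p q where f: "f = Fract p q" "q \<noteq> 0" by (cases f)
  obtain p' q' where g: "g = Fract p' q'" "q' \<noteq> 0" by (cases g)
  show "subst a b (f + g) = subst a b f + subst a b g"
    using f g by (simp add: subst_Fract eval2_add eval2_mult eval2_neq_0 field_simps)
  show "subst a b (f * g) = subst a b f * subst a b g"
    using f g by (simp add: subst_Fract eval2_mult)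
next
  fix c show "subst a b (const c) = const c"
    unfolding const_def[of c] by (subst subst_Fract) (simp_all add: eval2_const const_def)
qed

lemma subst_x1: "subst a b x1 = a" and subst_x2: "subst a b x2 = b"
  by (simp_all add: x1_def x2_def subst_Fract eval2_x1 eval2_x2)

end

section \<open>The grading of Laurent polynomials by the pairing with a vector\<close>

lemma pair_add_left: "pair (p + q) u = pair p u + pair q u"
  and pair_minus_left: "pair (- p) u = - pair p u"
  and pair_diff_left: "pair (p - q) u = pair p u - pair q u"
  and pair_smul_left: "pair (smul k p) u = k * pair p u"
  and pair_0_left: "pair 0 u = 0"
  and pair_add_right: "pair p (u + v) = pair p u + pair p v"
  and pair_minus_right: "pair p (- u) = - pair p u"
  and pair_smul_right: "pair p (smul k u) = k * pair p u"
  and pair_0_right: "pair p 0 = 0"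
  by (simp_all add: pair_def smul_def algebra_simps)

lemmas pair_linear = pair_add_left pair_minus_left pair_diff_left pair_smul_left pair_0_left
  pair_add_right pair_minus_right pair_smul_right pair_0_right

lemma lspan_one_plus_X_power:
  assumes "coeff_ring F" "pair d u = 0"
  shows "(1 + X d) ^ n \<in> lspan F {m. pair m u = 0}"
proof (rule lspan_power)
  have "X 0 + X d \<in> lspan F {m. pair m u = 0}"
    using assms by (intro lspan_add lspan_X) (simp_all add: pair_linear)
  then show "1 + X d \<in> lspan F {m. pair m u = 0}" by simp
qed (use assms in \<open>simp_all add: pair_linear\<close>)

text \<open>\<open>X d\<close> has degree 0 for the pairing with \<open>u\<close>, so all monomials
  of the product have the degree of \<open>X m\<close>.\<close>

lemma lspan_X_one_plus_X_powi:
  assumes "coeff_ring F" "pair d u = 0" "k \<ge> 0" "\<And>n. pair n u = pair m u \<Longrightarrow> n \<in> P"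
  shows "X m * (1 + X d) powi k \<in> lspan F P"
proof -
  have "X m * (1 + X d) ^ nat k \<in> lspan F P"
    using lspan_X[OF assms(1), of m "{m}"] lspan_one_plus_X_power[OF assms(1,2)] assms(1)
    by (rule lspan_mult) (simp_all add: assms(4) pair_linear)
  then show ?thesis
    using assms(3) by (simp add: power_int_def)
qed

text \<open>Among the terms with nonzero coefficient, those of least degree \<open>j\<close> become
  plain monomials after division by \<open>(1 + X d) powi j\<close>, while the others lie in degrees
  above \<open>j\<close>. The two groups cannot cancel each other.\<close>

lemma twisted_sum_eq_0_imp:
  assumes d: "d \<noteq> 0" "pair d u = 0" and "finite S" "m0 \<in> S"
    and sum0: "(\<Sum>m\<in>S. const (c m) * (X m * (1 + X d) powi pair m u)) = 0"
  shows "c m0 = 0"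
proof (rule ccontr)
  assume "c m0 \<noteq> 0"
  define A where "A = 1 + X d"
  have A: "A \<noteq> 0"
    unfolding A_def using one_plus_X_neq_0 d by blast
  define S' where "S' = {m \<in> S. c m \<noteq> 0}"
  have S': "finite S'" "S' \<noteq> {}"
    unfolding S'_def using \<open>finite S\<close> \<open>m0 \<in> S\<close> \<open>c m0 \<noteq> 0\<close> by (simp, blast)
  define j where "j = Min ((\<lambda>m. pair m u) ` S')"
  have j_le: "j \<le> pair m u" if "m \<in> S'" for m
    using that S' by (simp add: j_def)
  have "j \<in> (\<lambda>m. pair m u) ` S'"
    unfolding j_def using S' by (intro Min_in) auto
  then obtain m1 where m1: "m1 \<in> S'" "pair m1 u = j" by auto
  define S1 where "S1 = {m \<in> S'. pair m u = j}"
  define S2 where "S2 = {m \<in> S'. pair m u > j}"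
  have S12: "S' = S1 \<union> S2" "S1 \<inter> S2 = {}" "finite S1" "finite S2"
    using j_le S' by (force simp: S1_def S2_def)+
  define f where "f = (\<Sum>m\<in>S1. const (c m) * X m)"
  define g where "g = (\<Sum>m\<in>S2. const (c m) * (X m * A powi (pair m u - j)))"
  have "0 = A powi (- j) * (\<Sum>m\<in>S. const (c m) * (X m * A powi pair m u))"
    using sum0 by (simp add: A_def)
  also have "(\<Sum>m\<in>S. const (c m) * (X m * A powi pair m u))
      = (\<Sum>m\<in>S'. const (c m) * (X m * A powi pair m u))"
    using \<open>finite S\<close> by (intro sum.mono_neutral_right) (auto simp: S'_def)
  also have "A powi (- j) * (\<Sum>m\<in>S'. const (c m) * (X m * A powi pair m u))
      = (\<Sum>m\<in>S'. const (c m) * (X m * A powi (pair m u - j)))"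
    unfolding sum_distrib_left
    by (intro sum.cong) (simp_all add: power_int_diff power_int_minus A field_simps)
  also have "\<dots> = (\<Sum>m\<in>S1. const (c m) * (X m * A powi (pair m u - j))) + g"
    unfolding g_def S12(1) using S12 by (intro sum.union_disjoint) auto
  also have "(\<Sum>m\<in>S1. const (c m) * (X m * A powi (pair m u - j))) = f"
    unfolding f_def by (intro sum.cong) (auto simp: S1_def)
  finally have fg: "f = 0 - g"
    by (simp add: eq_neg_iff_add_eq_0)
  have "g \<in> lspan UNIV {m. pair m u > j}"
    unfolding g_def
  proof (intro lspan_sum S12)
    fix m assume "m \<in> S2"
    then have "X m * A powi (pair m u - j) \<in> lspan UNIV {m. pair m u > j}"
      unfolding A_def using d by (intro lspan_X_one_plus_X_powi coeff_ring_UNIV) (auto simp: S2_def)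
    from lspan_monom_mult[OF this coeff_ring_UNIV, of "c m" 0]
    show "const (c m) * (X m * A powi (pair m u - j)) \<in> lspan UNIV {m. pair m u > j}"
      by simp
  qed
  then have "f \<in> lspan UNIV {m. pair m u > j}"
    unfolding fg by (intro lspan_diff lspan.zero coeff_ring_UNIV)
  moreover have "f \<in> lspan UNIV {m. pair m u = j}"
    unfolding f_def by (intro lspan_sum S12 lspan_monom) (auto simp: S1_def)
  ultimately have "f = 0"
    by (rule lspan_disjoint) auto
  moreover have "m1 \<in> S1"
    using m1 by (simp add: S1_def)
  ultimately have "c m1 = 0"
    using X_sum_eq_0_imp[OF S12(3)] unfolding f_def by blast
  with m1 show False by (simp add: S'_def)
qed

section \<open>Twist automorphisms and their composition law\<close>

definition twist :: "int \<times> int \<Rightarrow> int \<times> int \<Rightarrow> K \<Rightarrow> K" where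
  "twist d u = subst (x1 * (1 + X d) powi fst u) (x2 * (1 + X d) powi snd u)"

text \<open>A polynomial evaluated at the two twisted generators is a linear combination of the
  twisted monomials \<open>X m * (1 + X d) powi pair m u\<close>, which are linearly
  independent.\<close>

lemma alg_independent_twist:
  assumes d: "d \<noteq> 0" "pair d u = 0"
  shows "alg_independent (x1 * (1 + X d) powi fst u) (x2 * (1 + X d) powi snd u)"
proof (unfold_locales, rule notI)
  fix q :: "complex poly poly"
  let ?a = "x1 * (1 + X d) powi fst u" and ?b = "x2 * (1 + X d) powi snd u"
  assume "q \<noteq> 0" and q0: "eval2 q ?a ?b = 0"
  obtain n where n: "\<And>a b. eval2 q a b
      = (\<Sum>(i, j)\<in>{..n} \<times> {..n}. const (coeff (coeff q j) i) * (a ^ i * b ^ j))"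
    and le: "\<And>i j. coeff (coeff q j) i \<noteq> 0 \<Longrightarrow> i \<le> n \<and> j \<le> n"
    by (rule eval2_conv_sum[of q]) blast
  obtain i0 j0 where nz: "coeff (coeff q j0) i0 \<noteq> 0"
    using \<open>q \<noteq> 0\<close> by (metis leading_coeff_0_iff)
  define c where "c m = coeff (coeff q (nat (snd m))) (nat (fst m))" for m :: "int \<times> int"
  define \<iota> where "\<iota> = (\<lambda>(i, j). (int i, int j))"
  have inj: "inj_on \<iota> ({..n} \<times> {..n})"
    by (auto simp: inj_on_def \<iota>_def)
  have A: "1 + X d \<noteq> 0"
    using one_plus_X_neq_0 d by blast
  have "?a ^ i * ?b ^ j = X (int i, int j) * (1 + X d) powi pair (int i, int j) u" for i j
    by (simp add: X_of_nat pair_def power_mult_distrib power_int_power' power_int_add A mult.commute)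
  then have "0 = (\<Sum>(i, j)\<in>{..n} \<times> {..n}. const (coeff (coeff q j) i)
      * (X (int i, int j) * (1 + X d) powi pair (int i, int j) u))"
    using q0 unfolding n by simp
  also have "\<dots> = (\<Sum>m\<in>\<iota> ` ({..n} \<times> {..n}). const (c m) * (X m * (1 + X d) powi pair m u))"
    by (subst sum.reindex[OF inj]) (simp add: c_def \<iota>_def case_prod_unfold)
  finally have "c (\<iota> (i0, j0)) = 0"
    using d le[OF nz] by (intro twisted_sum_eq_0_imp[of d u "\<iota> ` ({..n} \<times> {..n})"]) auto
  with nz show False by (simp add: c_def \<iota>_def)
qed

lemma K_hom_twist: "d \<noteq> 0 \<Longrightarrow> pair d u = 0 \<Longrightarrow> K_hom (twist d u)"
  unfolding twist_def by (intro alg_independent.K_hom_subst alg_independent_twist)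

lemma twist_x1: "d \<noteq> 0 \<Longrightarrow> pair d u = 0 \<Longrightarrow> twist d u x1 = x1 * (1 + X d) powi fst u"
  and twist_x2: "d \<noteq> 0 \<Longrightarrow> pair d u = 0 \<Longrightarrow> twist d u x2 = x2 * (1 + X d) powi snd u"
  unfolding twist_def
  by (intro alg_independent.subst_x1 alg_independent.subst_x2 alg_independent_twist; assumption)+

lemma twist_X:
  assumes d: "d \<noteq> 0" "pair d u = 0"
  shows "twist d u (X p) = X p * (1 + X d) powi pair p u"
proof -
  interpret K_hom "twist d u" using d by (rule K_hom_twist)
  have A: "1 + X d \<noteq> 0" using d one_plus_X_neq_0 by blast
  have "twist d u (X p)
      = (x1 * (1 + X d) powi fst u) powi fst p * (x2 * (1 + X d) powi snd u) powi snd p"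
    by (simp add: X_def[of p] mult powi twist_x1 twist_x2 d)
  also have "\<dots> = X p * (1 + X d) powi pair p u"
    by (simp add: X_def[of p] A pair_def power_int_mult_distrib power_int_add mult_ac flip: power_int_mult)
  finally show ?thesis .
qed

lemma twist_one_plus_X:
  assumes d: "d \<noteq> 0" "pair d u = 0"
  shows "twist d u (1 + X d) = 1 + X d"
proof -
  interpret K_hom "twist d u" using d by (rule K_hom_twist)
  show ?thesis by (simp add: add twist_X d)
qed

text \<open>The outer twist fixes \<open>1 + X d\<close>, so the exponents on the generators simply
  add.\<close>

lemma twist_twist:
  assumes "d \<noteq> 0" "pair d u = 0" "pair d u' = 0"
  shows "twist d u (twist d u' f) = twist d (u + u') f"
proof (rule K_hom_eqI[of "\<lambda>f. twist d u (twist d u' f)" "twist d (u + u')"])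
  interpret K_hom "twist d u" using assms by (intro K_hom_twist)
  have A: "1 + X d \<noteq> 0" using assms one_plus_X_neq_0 by blast
  have uu': "pair d (u + u') = 0" using assms by (simp add: pair_linear)
  show "K_hom (\<lambda>f. twist d u (twist d u' f))"
    by (rule K_hom_comp) (simp_all add: K_hom_twist assms)
  show "K_hom (twist d (u + u'))"
    using assms uu' by (intro K_hom_twist)
  show "twist d u (twist d u' x1) = twist d (u + u') x1"
    and "twist d u (twist d u' x2) = twist d (u + u') x2"
    using assms uu' A by (simp_all add: twist_x1 twist_x2 mult powi twist_one_plus_X power_int_add)
qed

lemma twist_0: "d \<noteq> 0 \<Longrightarrow> twist d 0 f = f"
  by (rule K_hom_eqI[of "twist d 0" "\<lambda>f. f"]) (simp_all add: K_hom_twist K_hom_id twist_x1 twist_x2 pair_linear)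

lemma twist_minus_cancel:
  "d \<noteq> 0 \<Longrightarrow> pair d u = 0 \<Longrightarrow> twist d (- u) (twist d u f) = f"
  "d \<noteq> 0 \<Longrightarrow> pair d u = 0 \<Longrightarrow> twist d u (twist d (- u) f) = f"
  by (simp_all add: twist_twist pair_linear twist_0)

section \<open>Images of spans of monomials, and polynomials with a Laurent twist\<close>

lemma (in K_hom) lspan_image:
  assumes "f \<in> lspan F P" "coeff_ring F" "\<And>m. m \<in> P \<Longrightarrow> \<phi> (X m) \<in> lspan F P'"
  shows "\<phi> f \<in> lspan F P'"
  using assms(1)
proof induction
  case (step c m f)
  have "const c * \<phi> (X m) \<in> lspan F P'"
    using lspan_monom_mult[OF assms(3)[OF \<open>m \<in> P\<close>] assms(2) \<open>c \<in> F\<close>, of 0 P'] by simp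
  with step show ?case
    by (simp add: add mult const lspan_add)
qed (simp add: lspan.zero)

text \<open>Each monomial of \<open>f\<close> needs some power of \<open>D\<close>, and
  \<open>J\<close> is stable under further factors \<open>D\<close>, so finitely many monomials have
  a common denominator.\<close>

lemma (in K_hom) lspan_image_denominator:
  assumes "f \<in> lspan F P" "\<And>m. m \<in> P \<Longrightarrow> \<exists>n. D ^ n * \<phi> (X m) \<in> J"
    and J: "0 \<in> J" "\<And>a b. a \<in> J \<Longrightarrow> b \<in> J \<Longrightarrow> a + b \<in> J"
      "\<And>a. a \<in> J \<Longrightarrow> D * a \<in> J" "\<And>a c. a \<in> J \<Longrightarrow> c \<in> F \<Longrightarrow> const c * a \<in> J"
  shows "\<exists>n. D ^ n * \<phi> f \<in> J"
  using assms(1)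
proof induction
  case zero
  then show ?case using J(1) by simp
next
  case (step c m f)
  have pow: "D ^ k * a \<in> J" if "a \<in> J" for a k
    by (induction k) (simp_all add: that J(3) mult.assoc)
  obtain i where i: "D ^ i * \<phi> (X m) \<in> J"
    using assms(2) step by blast
  obtain j where j: "D ^ j * \<phi> f \<in> J"
    using step by blast
  have "D ^ j * (const c * (D ^ i * \<phi> (X m))) + D ^ i * (D ^ j * \<phi> f) \<in> J"
    by (intro J(2) pow[OF J(4)[OF i \<open>c \<in> F\<close>]] pow[OF j])
  then have "D ^ (i + j) * \<phi> (const c * X m + f) \<in> J"
    by (simp add: add mult const power_add algebra_simps)
  then show ?case by blast
qed

text \<open>\<open>twist d u f\<close> is split by the sign of the degree and twisted back. The
  negative part returns as a Laurent polynomial, its powers of \<open>1 + X d\<close> being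
  positive, so the remainder \<open>r\<close> is Laurent too. Clearing the denominators of
  \<open>r\<close> shows that it has no monomials of negative degree.\<close>

lemma twist_laurent_decomp:
  assumes d: "d \<noteq> 0" "pair d u = 0" and f: "f \<in> laurent" "twist d u f \<in> laurent"
  obtains r s where "r \<in> lspan cyclo_field {p. 0 \<le> pair p u}"
    "s \<in> lspan cyclo_field {p. pair p u < 0}" "f = r + twist d (- u) s"
proof -
  note Q = coeff_ring_cyclo_field
  let ?A = "1 + X d" and ?P = "{p. 0 \<le> pair p u}" and ?M = "{p. pair p u < 0}"
  have compl: "UNIV - ?P = ?M" by auto
  have A: "?A \<noteq> 0" using d one_plus_X_neq_0 by blast
  have mu: "pair d (- u) = 0" using d by (simp add: pair_linear)
  interpret K_hom "twist d (- u)" using d mu by (intro K_hom_twist)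
  have A_mult: "?A ^ n * a \<in> lspan cyclo_field R"
    if "a \<in> lspan cyclo_field R" "\<And>m n. pair m u = 0 \<Longrightarrow> n \<in> R \<Longrightarrow> m + n \<in> R" for a n R
    using lspan_one_plus_X_power[OF Q d(2)] that(1) Q by (rule lspan_mult) (use that(2) in auto)
  obtain h s where hs: "h \<in> lspan cyclo_field ?P" "s \<in> lspan cyclo_field ?M"
      "twist d u f = h + s"
    using lspan_split[OF f(2)[unfolded laurent_eq_lspan], of ?P] unfolding compl by auto
  define r where "r = twist d (- u) h"
  have fr: "f = r + twist d (- u) s"
    using twist_minus_cancel(1)[OF d, of f] by (simp add: hs(3) add r_def)
  have "twist d (- u) s \<in> lspan cyclo_field ?M"
    using hs(2) Q
  proof (rule lspan_image)
    fix m assume "m \<in> ?M"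
    then show "twist d (- u) (X m) \<in> lspan cyclo_field ?M"
      unfolding twist_X[OF d(1) mu] using Q d
      by (intro lspan_X_one_plus_X_powi[of _ d u]) (auto simp: pair_linear)
  qed
  then have "twist d (- u) s \<in> lspan cyclo_field UNIV"
    by (rule lspan_mono) auto
  then have "f - twist d (- u) s \<in> lspan cyclo_field UNIV"
    using f Q by (intro lspan_diff) (auto simp: laurent_eq_lspan)
  then have "r \<in> lspan cyclo_field UNIV"
    by (simp add: fr)
  then obtain r1 r2 where r12: "r1 \<in> lspan cyclo_field ?P" "r2 \<in> lspan cyclo_field ?M" "r = r1 + r2"
    using lspan_split[of r cyclo_field UNIV ?P] unfolding compl by auto
  \<comment> \<open>Twisting \<open>h\<close> back introduces only powers of \<open>?A\<close> as
    denominators, and clearing them preserves degrees because \<open>?A\<close> has degree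
    0.\<close>
  have "\<exists>n. ?A ^ n * r \<in> lspan cyclo_field ?P"
    unfolding r_def using hs(1)
  proof (rule lspan_image_denominator)
    fix m assume m: "m \<in> ?P"
    have "X m \<in> lspan cyclo_field ?P"
      using m Q by (rule lspan_X[rotated])
    moreover have "?A ^ nat (pair m u) * twist d (- u) (X m) = X m"
      unfolding twist_X[OF d(1) mu] using m A
      by (simp add: pair_linear power_int_def power_inverse)
    ultimately show "\<exists>n. ?A ^ n * twist d (- u) (X m) \<in> lspan cyclo_field ?P"
      by metis
  next
    fix a assume "a \<in> lspan cyclo_field ?P"
    from A_mult[OF this, of 1] show "?A * a \<in> lspan cyclo_field ?P"
      by (simp add: pair_linear)
  next
    fix a c assume "a \<in> lspan cyclo_field ?P" "c \<in> cyclo_field"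
    from lspan_monom_mult[OF this(1) Q this(2), of 0 ?P]
    show "const c * a \<in> lspan cyclo_field ?P" by simp
  qed (auto intro: lspan.zero lspan_add)
  then obtain n where n: "?A ^ n * r \<in> lspan cyclo_field ?P" by blast
  have "?A ^ n * r1 \<in> lspan cyclo_field ?P"
    using r12(1) by (rule A_mult) (simp add: pair_linear)
  with n have "?A ^ n * r - ?A ^ n * r1 \<in> lspan cyclo_field ?P"
    using Q by (rule lspan_diff)
  then have "?A ^ n * r2 \<in> lspan cyclo_field ?P"
    by (simp add: r12(3) algebra_simps)
  moreover have "?A ^ n * r2 \<in> lspan cyclo_field ?M"
    using r12(2) by (rule A_mult) (simp add: pair_linear)
  ultimately have "?A ^ n * r2 = 0"
    by (rule lspan_disjoint) auto
  then have "r = r1"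
    using A r12 by simp
  then show thesis
    using that r12(1) hs(2) fr by blast
qed

section \<open>Twists and Laurent polynomials\<close>

lemma laurent_0: "0 \<in> laurent"
  and laurent_X: "X m \<in> laurent"
  and laurent_add: "f \<in> laurent \<Longrightarrow> g \<in> laurent \<Longrightarrow> f + g \<in> laurent"
  and laurent_diff: "f \<in> laurent \<Longrightarrow> g \<in> laurent \<Longrightarrow> f - g \<in> laurent"
  and laurent_mult: "f \<in> laurent \<Longrightarrow> g \<in> laurent \<Longrightarrow> f * g \<in> laurent"
  unfolding laurent_eq_lspan
  by (simp_all add: lspan.zero lspan_X lspan_add lspan_diff lspan_mult coeff_ring_cyclo_field)

lemma laurent_const: "c \<in> cyclo_field \<Longrightarrow> const c \<in> laurent"
  unfolding laurent_eq_lspan using lspan_monom[of c cyclo_field 0 UNIV] by simp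

lemma laurent_X_one_plus_X_powi: "k \<ge> 0 \<Longrightarrow> X m * (1 + X d) powi k \<in> laurent"
  unfolding laurent_eq_lspan
  by (rule lspan_X_one_plus_X_powi[where u = 0]) (simp_all add: coeff_ring_cyclo_field pair_linear)

text \<open>By the decomposition \<open>f = r + twist d (- u) s\<close> it is enough to test
  \<open>\<phi>\<close> on monomials of nonnegative degree and on twisted-back monomials of negative
  degree.\<close>

lemma twist_laurent_hom:
  assumes d: "d \<noteq> 0" "pair d u = 0" and f: "f \<in> laurent" "twist d u f \<in> laurent"
    and "K_hom \<phi>"
    and pos: "\<And>p. 0 \<le> pair p u \<Longrightarrow> \<phi> (X p) \<in> laurent"
    and neg: "\<And>p. pair p u < 0 \<Longrightarrow> \<phi> (twist d (- u) (X p)) \<in> laurent"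
  shows "\<phi> f \<in> laurent"
proof -
  interpret K_hom \<phi> by fact
  have mu: "pair d (- u) = 0" using d by (simp add: pair_linear)
  interpret c: K_hom "\<lambda>f. \<phi> (twist d (- u) f)"
    by (rule K_hom_comp[OF \<open>K_hom \<phi>\<close> K_hom_twist[OF d(1) mu]])
  obtain r s where rs: "r \<in> lspan cyclo_field {p. 0 \<le> pair p u}"
    "s \<in> lspan cyclo_field {p. pair p u < 0}" "f = r + twist d (- u) s"
    using d f by (rule twist_laurent_decomp)
  have "\<phi> r \<in> lspan cyclo_field UNIV"
    using rs(1) coeff_ring_cyclo_field
    by (rule lspan_image) (use pos in \<open>simp add: laurent_eq_lspan\<close>)
  moreover have "\<phi> (twist d (- u) s) \<in> lspan cyclo_field UNIV"
    using rs(2) coeff_ring_cyclo_field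
    by (rule c.lspan_image) (use neg in \<open>simp add: laurent_eq_lspan\<close>)
  ultimately show ?thesis
    by (simp add: rs(3) add laurent_eq_lspan lspan_add)
qed

text \<open>On monomials of nonnegative degree the single twist has a nonnegative exponent. On the
  generators twisted back by \<open>- smul a v\<close> it leaves the exponent
  \<open>(1 - a) * pair p v\<close>, again nonnegative since \<open>pair p v\<close> is
  negative.\<close>

lemma twist_laurent_convex:
  assumes d: "d \<noteq> 0" "pair d v = 0" and "a \<ge> 1"
    and f: "f \<in> laurent" "twist d (smul a v) f \<in> laurent"
  shows "twist d v f \<in> laurent"
proof (rule twist_laurent_hom[OF d(1) _ f K_hom_twist[OF d]])
  show "pair d (smul a v) = 0" using d by (simp add: pair_linear)
next
  fix p assume "0 \<le> pair p (smul a v)"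
  then have "0 \<le> pair p v"
    using \<open>a \<ge> 1\<close> by (simp add: pair_linear zero_le_mult_iff)
  then show "twist d v (X p) \<in> laurent"
    by (simp add: twist_X d laurent_X_one_plus_X_powi)
next
  fix p assume "pair p (smul a v) < 0"
  then have "pair p v < 0"
    using \<open>a \<ge> 1\<close> by (simp add: pair_linear mult_less_0_iff)
  then have "0 \<le> (1 - a) * pair p v"
    using \<open>a \<ge> 1\<close> by (intro mult_nonpos_nonpos) auto
  then have "0 \<le> pair p (v + - smul a v)"
    by (simp only: pair_linear) (simp add: algebra_simps)
  moreover have d': "pair d (v + - smul a v) = 0" "pair d (- smul a v) = 0"
    using d by (simp_all only: pair_linear)
  ultimately show "twist d v (twist d (- smul a v) (X p)) \<in> laurent"
    unfolding twist_twist[OF d d'(2)] twist_X[OF d(1) d'(1)] by (intro laurent_X_one_plus_X_powi)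
qed

text \<open>Since \<open>1 + X d = X d * (1 + X (- d))\<close>, the twists along \<open>d\<close>
  and \<open>- d\<close> differ by a monomial substitution; on generators of negative degree the
  binomials cancel. This links the conditions for \<open>v\<close> and \<open>- v\<close>.\<close>

lemma twist_laurent_flip:
  assumes d: "d \<noteq> 0" "pair d u = 0" and f: "f \<in> laurent" "twist d u f \<in> laurent"
  shows "twist (- d) u f \<in> laurent"
proof -
  have d': "- d \<noteq> 0" "pair (- d) u = 0" and mu: "pair d (- u) = 0"
    using d by (simp_all add: pair_linear)
  interpret K_hom "twist (- d) u" using d' by (rule K_hom_twist)
  have A: "1 + X (- d) \<noteq> 0" using d' one_plus_X_neq_0 by blast
  have Ad: "1 + X d = X d * (1 + X (- d))"
    by (simp add: X_minus field_simps)
  show ?thesis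
  proof (rule twist_laurent_hom[OF d f K_hom_twist[OF d']])
    fix p assume "0 \<le> pair p u"
    then show "twist (- d) u (X p) \<in> laurent"
      by (simp add: twist_X[OF d'] laurent_X_one_plus_X_powi)
  next
    fix p
    have "twist (- d) u (X d) = X d"
      using d d' by (simp add: twist_X)
    then have "twist (- d) u (1 + X d) = X d * (1 + X (- d))"
      by (simp add: add flip: Ad)
    then have "twist (- d) u (twist d (- u) (X p))
        = X p * (1 + X (- d)) powi pair p u * (X d * (1 + X (- d))) powi (- pair p u)"
      by (simp add: twist_X[OF d(1) mu] mult powi twist_X[OF d'] pair_linear)
    also have "\<dots> = X p * X (smul (- pair p u) d)"
      using A by (simp add: X_smul power_int_mult_distrib power_int_minus)
    finally show "twist (- d) u (twist d (- u) (X p)) \<in> laurent"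
      by (simp add: laurent_mult laurent_X)
  qed
qed

text \<open>
  Stated for an arbitrary \<open>\<sigma>\<close> so that it covers both signs of \<open>\<omega>(v,u)\<close> and both directions of the
  mutation.
\<close>

lemma twist_laurent_transfer:
  fixes \<sigma> :: "K \<Rightarrow> K" and \<tau> :: "int \<times> int \<Rightarrow> int \<times> int" and m :: int
  assumes e: "e \<noteq> 0" "pair e u = 0" and e': "e' \<noteq> 0" "pair e' u' = 0" and "m > 0"
    and "K_hom \<sigma>" and \<sigma>X: "\<And>p. \<sigma> (X p) = X (\<tau> p) * (1 + X \<delta>) powi l p"
    and \<delta>: "pair \<delta> u' > 0" and \<tau>: "\<And>p. pair (\<tau> p) u' = pair p u" "\<tau> e = e'"
    and f: "f \<in> laurent" "twist e (smul m u) f \<in> laurent" "\<sigma> f \<in> laurent"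
  shows "twist e' (smul m u') (\<sigma> f) \<in> laurent"
proof -
  interpret K_hom \<sigma> by fact
  have mu: "pair e (smul m u) = 0" "pair e (- smul m u) = 0" "pair e' (smul m u') = 0"
    using e e' by (simp_all add: pair_linear)
  interpret T: K_hom "twist e' (smul m u')" using e'(1) mu(3) by (rule K_hom_twist)
  interpret S: K_hom "\<lambda>f. \<sigma> (twist e (- smul m u) f)"
    by (rule K_hom_comp[OF \<open>K_hom \<sigma>\<close> K_hom_twist[OF e(1) mu(2)]])
  \<comment> \<open>The claim becomes \<open>\<sigma> f \<in> J\<close>. The argument rests on
    \<open>J\<close> being a ring that contains \<open>X \<delta>\<close> and
    \<open>D\<close>.\<close>
  define J where "J = {g \<in> laurent. twist e' (smul m u') g \<in> laurent}"
  have J_0: "0 \<in> J"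
    by (simp add: J_def laurent_0)
  have J_add: "a + b \<in> J" and J_diff: "a - b \<in> J" and J_mult: "a * b \<in> J" if "a \<in> J" "b \<in> J" for a b
  proof -
    show "a + b \<in> J" "a * b \<in> J"
      using that by (simp_all add: J_def T.add T.mult laurent_add laurent_mult)
    have "twist e' (smul m u') (a - b) = twist e' (smul m u') a - twist e' (smul m u') b"
      using T.add[of "a - b" b] by simp
    then show "a - b \<in> J"
      using that by (simp add: J_def laurent_diff)
  qed
  have J_const: "const c * a \<in> J" if "a \<in> J" "c \<in> cyclo_field" for a c
    using that by (simp add: J_def T.mult T.const laurent_const laurent_mult)
  define B where "B = 1 + X e"
  define B' where "B' = 1 + X e'"
  define D where "D = 1 + X \<delta>"
  have "\<delta> \<noteq> 0" using \<delta> by (auto simp: pair_linear)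
  then have D0: "D \<noteq> 0" unfolding D_def by (rule one_plus_X_neq_0)
  have B'0: "B' \<noteq> 0" unfolding B'_def using e' by (intro one_plus_X_neq_0)
  \<comment> \<open>The twist fixes \<open>B'\<close> and multiplies \<open>X q\<close> by
    \<open>B' powi (m * pair q u')\<close>, so \<open>k\<close> factors \<open>B'\<close> make up
    for an exponent as low as \<open>- k\<close>.\<close>
  have J_B: "B' ^ k * X q \<in> J" if "int k + m * pair q u' \<ge> 0" for k q
  proof -
    have "B' ^ k * X q \<in> laurent"
      using laurent_X_one_plus_X_powi[of "int k" q e'] by (simp add: B'_def mult.commute)
    moreover have "twist e' (smul m u') (B' ^ k * X q) = B' ^ k * (X q * B' powi (m * pair q u'))"
      by (simp add: T.mult T.power twist_X twist_one_plus_X B'_def e' mu pair_linear)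
    then have "twist e' (smul m u') (B' ^ k * X q) = X q * B' powi (int k + m * pair q u')"
      using B'0 by (simp add: power_int_add mult_ac)
    then have "twist e' (smul m u') (B' ^ k * X q) \<in> laurent"
      using that by (simp add: B'_def laurent_X_one_plus_X_powi)
    ultimately show ?thesis by (simp add: J_def)
  qed
  have J_X: "X q \<in> J" if "pair q u' \<ge> 0" for q
    using J_B[of 0 q] that \<open>m > 0\<close> by simp
  have J_1: "1 \<in> J"
    using J_X[of 0] by (simp add: pair_linear)
  have J_D: "D \<in> J"
    unfolding D_def using \<delta> by (intro J_add J_1 J_X) simp
  have J_D_power: "D ^ n \<in> J" for n
    by (induction n) (simp_all add: J_1 J_D J_mult)
  have D_power: "\<exists>Z\<in>J. D ^ n = 1 + X \<delta> * Z" for n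
  proof (induction n)
    case 0
    show ?case using J_0 by (intro bexI[of _ 0]) auto
  next
    case (Suc n)
    then obtain Z where "Z \<in> J" "D ^ n = 1 + X \<delta> * Z" by blast
    then show ?case
      by (intro bexI[of _ "D * Z + 1"] J_add J_mult J_D J_1) (auto simp: D_def algebra_simps)
  qed
  have \<sigma>B: "\<sigma> B = 1 + X e' * D powi l e"
    by (simp add: B_def D_def add \<sigma>X \<tau>)
  \<comment> \<open>Up to a power of \<open>D\<close>, \<open>\<sigma> B\<close> agrees with
    \<open>B'\<close> modulo \<open>X \<delta>\<close> times \<open>J\<close>. The error comes from
    the term with \<open>X e'\<close> if \<open>l e\<close> is nonnegative, and otherwise from the
    constant term, once \<open>D\<close> has cleared the denominator.\<close>
  have "\<exists>n. \<exists>Z\<in>J. D ^ n * \<sigma> B = B' + X \<delta> * Z"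
  proof (cases "l e \<ge> 0")
    case True
    obtain Z where Z: "Z \<in> J" "D ^ nat (l e) = 1 + X \<delta> * Z" using D_power by blast
    have "D ^ 0 * \<sigma> B = B' + X \<delta> * (X e' * Z)"
      using True Z(2) by (simp add: \<sigma>B B'_def power_int_def algebra_simps)
    moreover have "X e' * Z \<in> J"
      using Z(1) e' by (intro J_mult J_X) simp_all
    ultimately show ?thesis by blast
  next
    case False
    obtain Z where Z: "Z \<in> J" "D ^ nat (- l e) = 1 + X \<delta> * Z" using D_power by blast
    have "D ^ nat (- l e) * D powi l e = 1"
      using False D0 by (simp add: power_int_def power_inverse)
    then have "D ^ nat (- l e) * \<sigma> B = D ^ nat (- l e) + X e'"
      by (simp add: \<sigma>B algebra_simps)
    then have "D ^ nat (- l e) * \<sigma> B = B' + X \<delta> * Z"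
      by (simp add: Z(2) B'_def)
    with Z(1) show ?thesis by blast
  qed
  then obtain n Z where nZ: "Z \<in> J" "D ^ n * \<sigma> B = B' + X \<delta> * Z" by blast
  define P where "P = D ^ n * \<sigma> B"
  \<comment> \<open>One factor \<open>P = B' + X \<delta> * Z\<close> is expanded at a time:
    \<open>B'\<close> raises \<open>k\<close> by one, and \<open>X \<delta>\<close> raises
    \<open>m * pair q u'\<close> by at least \<open>m\<close>. Either gain makes up for the lost
    factor.\<close>
  have J_P: "P ^ i * (B' ^ k * X q) \<in> J" if "int i + int k + m * pair q u' \<ge> 0" for i k q
    using that
  proof (induction i arbitrary: k q)
    case 0
    then show ?case by (simp add: J_B)
  next
    case (Suc i)
    have "m * 1 \<le> m * pair \<delta> u'"
      using \<delta> \<open>m > 0\<close> by (intro mult_left_mono) auto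
    then have "int i + int k + m * pair (q + \<delta>) u' \<ge> 0"
      using Suc.prems \<open>m > 0\<close> unfolding pair_linear distrib_left by linarith
    then have "P ^ i * (B' ^ k * X (q + \<delta>)) \<in> J"
      by (rule Suc.IH)
    moreover have "P ^ i * (B' ^ Suc k * X q) \<in> J"
      using Suc.prems by (intro Suc.IH) simp
    ultimately have "P ^ i * (B' ^ Suc k * X q) + Z * (P ^ i * (B' ^ k * X (q + \<delta>))) \<in> J"
      by (blast intro: J_add J_mult[OF nZ(1)])
    moreover have "P ^ Suc i * (B' ^ k * X q) = (B' + X \<delta> * Z) * (P ^ i * (B' ^ k * X q))"
      by (simp only: P_def[symmetric] nZ(2)[symmetric] power_Suc mult.assoc)
    then have "P ^ Suc i * (B' ^ k * X q)
        = P ^ i * (B' ^ Suc k * X q) + Z * (P ^ i * (B' ^ k * X (q + \<delta>)))"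
      by (simp add: X_add algebra_simps)
    ultimately show ?case by simp
  qed
  \<comment> \<open>With the absolute value of \<open>k\<close> as exponent, \<open>D\<close> clears
    the denominator for either sign of \<open>k\<close> and leaves a nonnegative power.\<close>
  have D_abs: "D ^ nat \<bar>k\<bar> * D powi k = D ^ nat (\<bar>k\<bar> + k)" for k :: int
  proof (cases "k \<ge> 0")
    case True
    then have "nat (\<bar>k\<bar> + k) = nat k + nat k" by linarith
    with True show ?thesis by (simp add: power_int_def power_add)
  qed (use D0 in \<open>simp add: power_int_def power_inverse\<close>)
  obtain r s where rs: "r \<in> lspan cyclo_field {p. 0 \<le> pair p (smul m u)}"
    "s \<in> lspan cyclo_field {p. pair p (smul m u) < 0}" "f = r + twist e (- smul m u) s"
    using e(1) mu(1) f(1,2) by (rule twist_laurent_decomp)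
  have "\<exists>n. D ^ n * \<sigma> r \<in> J"
    using rs(1)
  proof (rule lspan_image_denominator)
    fix p assume "p \<in> {p. 0 \<le> pair p (smul m u)}"
    then have "pair (\<tau> p) u' \<ge> 0"
      using \<open>m > 0\<close> by (simp add: \<tau> pair_linear zero_le_mult_iff)
    then have "D ^ nat (\<bar>l p\<bar> + l p) * X (\<tau> p) \<in> J"
      by (intro J_mult J_D_power J_X)
    also have "D ^ nat (\<bar>l p\<bar> + l p) * X (\<tau> p) = D ^ nat \<bar>l p\<bar> * \<sigma> (X p)"
      by (simp add: \<sigma>X D_abs[symmetric] D_def[symmetric] mult_ac)
    finally show "\<exists>n. D ^ n * \<sigma> (X p) \<in> J" by blast
  qed (simp_all add: J_0 J_add J_mult J_D J_const)
  then obtain n1 where n1: "D ^ n1 * \<sigma> r \<in> J" by blast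
  have "\<exists>n. D ^ n * \<sigma> (twist e (- smul m u) s) \<in> J"
    using rs(2)
  proof (rule S.lspan_image_denominator)
    fix p assume "p \<in> {p. pair p (smul m u) < 0}"
    then have neg: "m * pair p u < 0"
      by (simp add: pair_linear)
    \<comment> \<open>The exponent of \<open>B\<close> in the twisted-back monomial, which is
      exactly the deficit that \<open>k\<close> factors \<open>P\<close> absorb.\<close>
    define k where "k = nat (- (m * pair p u))"
    have k: "int k = - (m * pair p u)"
      using neg by (simp add: k_def)
    have "P ^ k * (B' ^ 0 * X (\<tau> p)) \<in> J"
      by (rule J_P) (simp add: k \<tau>)
    then have "D ^ nat (\<bar>l p\<bar> + l p) * (P ^ k * (B' ^ 0 * X (\<tau> p))) \<in> J"
      by (rule J_mult[OF J_D_power])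
    also have "D ^ nat (\<bar>l p\<bar> + l p) * (P ^ k * (B' ^ 0 * X (\<tau> p)))
        = D ^ (nat \<bar>l p\<bar> + n * k) * (X (\<tau> p) * D powi l p * \<sigma> B ^ k)"
      by (simp add: P_def D_abs[symmetric] power_mult_distrib power_add mult_ac flip: power_mult)
    also have "X (\<tau> p) * D powi l p * \<sigma> B ^ k = \<sigma> (X p * B powi int k)"
      by (simp add: mult \<sigma>X power D_def)
    also have "X p * B powi int k = twist e (- smul m u) (X p)"
      using k by (simp add: twist_X[OF e(1) mu(2)] B_def[symmetric] pair_linear del: power_int_of_nat)
    finally show "\<exists>n. D ^ n * \<sigma> (twist e (- smul m u) (X p)) \<in> J" by blast
  qed (simp_all add: J_0 J_add J_mult J_D J_const)
  then obtain n2 where n2: "D ^ n2 * \<sigma> (twist e (- smul m u) s) \<in> J" by blast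
  have "D ^ n2 * (D ^ n1 * \<sigma> r) + D ^ n1 * (D ^ n2 * \<sigma> (twist e (- smul m u) s)) \<in> J"
    by (intro J_add J_mult[OF J_D_power] n1 n2)
  then have D_mult: "D ^ (n1 + n2) * \<sigma> f \<in> J"
    by (simp add: rs(3) add power_add algebra_simps)
  have cancel: "h \<in> J" if h: "h \<in> laurent" "D * h \<in> J" for h
  proof -
    have "\<exists>n. X \<delta> ^ n * h \<in> J"
      using h(1)[unfolded laurent_eq_lspan]
    proof (rule K_hom.lspan_image_denominator[OF K_hom_id])
      fix q :: "int \<times> int"
      \<comment> \<open>Every factor \<open>X \<delta>\<close> raises the degree by at least one, so
        this many bring it to at least 0.\<close>
      define k where "k = nat \<bar>pair q u'\<bar>"
      have "int k * 1 \<le> int k * pair \<delta> u'"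
        using \<delta> by (intro mult_left_mono) auto
      then have "0 \<le> pair (smul (int k) \<delta> + q) u'"
        unfolding k_def pair_linear by linarith
      then have "X (smul (int k) \<delta> + q) \<in> J"
        by (rule J_X)
      then have "X \<delta> ^ k * X q \<in> J"
        by (simp add: X_add X_smul)
      then show "\<exists>n. X \<delta> ^ n * X q \<in> J" by blast
    next
      fix a assume "a \<in> J"
      then show "X \<delta> * a \<in> J" using \<delta> by (intro J_mult J_X) simp_all
    qed (use J_0 J_add J_const in \<open>blast+\<close>)
    then obtain n where "X \<delta> ^ n * h \<in> J" by blast
    then show ?thesis
    proof (induction n)
      case (Suc n)
      have X_power: "X \<delta> ^ n \<in> J"
        using J_X[of "smul (int n) \<delta>"] \<delta> by (simp add: X_smul pair_linear)
      have "X \<delta> ^ n * (D * h) - X \<delta> ^ Suc n * h \<in> J"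
        by (rule J_diff[OF J_mult[OF X_power h(2)] Suc.prems])
      moreover have "X \<delta> ^ n * (D * h) - X \<delta> ^ Suc n * h = X \<delta> ^ n * h"
        unfolding D_def distrib_left distrib_right by (simp add: mult_ac)
      ultimately have "X \<delta> ^ n * h \<in> J" by (simp only:)
      then show ?case by (rule Suc.IH)
    qed simp
  qed
  \<comment> \<open>The factors \<open>D\<close> are cancelled one by one; each intermediate product
    is Laurent because \<open>\<sigma> f\<close> is.\<close>
  have "\<sigma> f \<in> J" if "D ^ k * \<sigma> f \<in> J" for k
    using that
  proof (induction k)
    case (Suc k)
    have "D ^ k * \<sigma> f \<in> laurent"
      using J_D_power[of k] f(3) by (simp add: J_def laurent_mult)
    moreover have "D * (D ^ k * \<sigma> f) \<in> J"
      using Suc.prems by (simp add: mult.assoc)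
    ultimately show ?case
      by (rule Suc.IH[OF cancel])
  qed simp
  with D_mult have "\<sigma> f \<in> J" by blast
  then show ?thesis by (simp add: J_def)
qed

section \<open>Upper bounds and mutations\<close>

lemma smul_simps:
  "smul 0 v = 0" "smul 1 v = v" "smul (- 1) v = - v" "smul k 0 = 0"
  "smul (j + k) v = smul j v + smul k v" "smul k (u + v) = smul k u + smul k v"
  "smul j (smul k v) = smul (j * k) v" "smul (- k) v = - smul k v" "smul k (- v) = - smul k v"
  by (simp_all add: smul_def prod_eq_iff algebra_simps)

section \<open>Primitive vectors and multiplicities\<close>

lemma primitive_iff_coprime: "primitive v \<longleftrightarrow> coprime (fst v) (snd v)"
proof
  assume prim: "primitive v"
  define g where "g = gcd (fst v) (snd v)"
  have "v = smul g (fst v div g, snd v div g)"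
    by (simp add: smul_def g_def prod_eq_iff)
  then have "\<not> g > 1"
    using prim unfolding primitive_def by blast
  moreover have "g \<noteq> 0"
    using prim by (simp add: g_def primitive_def prod_eq_iff)
  moreover have "g \<ge> 0"
    by (simp add: g_def)
  ultimately have "g = 1" by linarith
  then show "coprime (fst v) (snd v)"
    by (simp add: g_def coprime_iff_gcd_eq_1)
next
  assume cop: "coprime (fst v) (snd v)"
  show "primitive v"
    unfolding primitive_def
  proof (intro conjI notI)
    assume "v = 0"
    with cop show False by simp
  next
    assume "\<exists>k w. 1 < k \<and> v = smul k w"
    then obtain k w where "k > 1" "v = smul k w" by blast
    then have "k dvd fst v" "k dvd snd v"
      by (simp_all add: smul_def)
    then have "is_unit k"
      using cop by (meson coprime_common_divisor)
    with \<open>k > 1\<close> show False by simp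
  qed
qed

lemma primitive_minus: "primitive v \<Longrightarrow> primitive (- v)"
  by (simp add: primitive_iff_coprime)

text \<open>Coprimality and proportionality make corresponding coordinates divide each other, so
  they agree up to sign; proportionality then couples the two signs.\<close>

lemma primitive_parallel:
  assumes "primitive u" "primitive v" "fst v * snd u = snd v * fst u"
  shows "u = v \<or> u = - v"
proof -
  have cop: "coprime (fst u) (snd u)" "coprime (fst v) (snd v)"
    "coprime (snd u) (fst u)" "coprime (snd v) (fst v)"
    using assms by (simp_all add: primitive_iff_coprime coprime_commute)
  have "fst u dvd fst v * snd u" "fst v dvd snd v * fst u"
    "snd u dvd snd v * fst u" "snd v dvd fst v * snd u"
    using assms(3) by (metis dvd_triv_left dvd_triv_right)+
  then have dvd: "fst u dvd fst v" "fst v dvd fst u" "snd u dvd snd v" "snd v dvd snd u"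
    using cop by (simp_all add: coprime_dvd_mult_left_iff coprime_dvd_mult_right_iff)
  have abs: "\<bar>fst u\<bar> = \<bar>fst v\<bar>" "\<bar>snd u\<bar> = \<bar>snd v\<bar>"
    by (rule zdvd_antisym_abs[OF dvd(1,2)], rule zdvd_antisym_abs[OF dvd(3,4)])
  show ?thesis
  proof (cases "fst v = 0 \<or> snd v = 0")
    case True
    with abs show ?thesis by (auto simp: prod_eq_iff abs_eq_iff)
  next
    case False
    then show ?thesis
      using abs assms(3) by (auto simp: prod_eq_iff abs_eq_iff)
  qed
qed

lemma mult_fun_eq_card: "mult_fun V v = card {j. j < length V \<and> V ! j = v}"
  by (simp add: mult_fun_def length_filter_conv_card)

lemma mult_fun_eq_0_iff: "mult_fun V v = 0 \<longleftrightarrow> v \<notin> set V"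
  by (auto simp: mult_fun_def filter_empty_conv)

section \<open>The skew form, and the upper bound in terms of twists\<close>

locale nondegenerate_skew_form =
  fixes \<omega> :: "int \<times> int \<Rightarrow> int \<times> int \<Rightarrow> int"
  assumes bilin_left: "\<omega> (u + u') v = \<omega> u v + \<omega> u' v"
    and bilin_right: "\<omega> u (v + v') = \<omega> u v + \<omega> u v'"
    and scal_left: "\<omega> (smul k u) v = k * \<omega> u v"
    and scal_right: "\<omega> u (smul k v) = k * \<omega> u v"
    and skew: "\<omega> u v = - \<omega> v u"
    and nondeg: "(\<forall>v. \<omega> u v = 0) \<Longrightarrow> u = 0"
begin

abbreviation dual :: "int \<times> int \<Rightarrow> int \<times> int" where
  "dual v \<equiv> omega_dual \<omega> v"

lemma omega_self [simp]: "\<omega> v v = 0"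
  using skew[of v v] by simp

lemma omega_minus: "\<omega> u (- v) = - \<omega> u v"
  using scal_right[of u "- 1" v] by (simp add: smul_simps)

lemma pair_dual: "pair (dual v) u = \<omega> u v"
proof -
  have "\<omega> u v = \<omega> (smul (fst u) (1, 0) + smul (snd u) (0, 1)) v"
    by (simp add: smul_def)
  also have "\<dots> = pair (dual v) u"
    by (simp only: bilin_left scal_left) (simp add: pair_def omega_dual_def)
  finally show ?thesis by simp
qed

lemma dual_add: "dual (u + v) = dual u + dual v"
  and dual_smul: "dual (smul k v) = smul k (dual v)"
  by (simp_all add: omega_dual_def bilin_right scal_right) (simp add: smul_def)

lemma dual_minus: "dual (- v) = - dual v"
  using dual_smul[of "- 1" v] by (simp add: smul_simps)

lemma dual_neq_0:
  assumes "v \<noteq> 0"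
  shows "dual v \<noteq> 0"
proof
  assume "dual v = 0"
  then have "\<omega> u v = 0" for u
    using pair_dual[of v u] by (simp add: pair_linear)
  then have "\<forall>u. \<omega> v u = 0"
    using skew by (metis neg_equal_0_iff_equal)
  with assms show False using nondeg by blast
qed

text \<open>In rank 2 a skew form is a multiple \<open>k\<close> of the determinant, and
  nondegeneracy makes \<open>k\<close> nonzero.\<close>

lemma omega_eq_0_imp_parallel:
  assumes "primitive u" "primitive v" "\<omega> v u = 0"
  shows "u = v \<or> u = - v"
proof (rule primitive_parallel[OF assms(1,2)])
  define k where "k = \<omega> (1, 0) (0, 1)"
  have form: "\<omega> x y = k * (fst x * snd y - snd x * fst y)" for x y
  proof -
    have "\<omega> x y = pair (dual y) x" by (simp add: pair_dual)
    also have "\<dots> = fst x * \<omega> (1, 0) y + snd x * \<omega> (0, 1) y"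
      by (simp add: pair_def omega_dual_def mult.commute)
    also have "\<omega> (1, 0) y = pair (- dual (1, 0)) y"
      using skew[of "(1, 0)" y] by (simp add: pair_linear pair_dual)
    also have "\<dots> = snd y * k"
      using skew[of "(0, 1)" "(1, 0)"] by (simp add: pair_def omega_dual_def k_def)
    also have "\<omega> (0, 1) y = pair (- dual (0, 1)) y"
      using skew[of "(0, 1)" y] by (simp add: pair_linear pair_dual)
    also have "\<dots> = - (fst y * k)"
      by (simp add: pair_def omega_dual_def k_def)
    finally show ?thesis by (simp add: algebra_simps)
  qed
  have "k \<noteq> 0"
    using nondeg[of "(1, 0)"] form by (auto simp: prod_eq_iff)
  with assms(3) form[of v u] show "fst v * snd u = snd v * fst u" by simp
qed

lemma mu_star_eq_twist: "mu_star \<omega> v = twist (dual v) (- v)"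
  by (simp add: fun_eq_iff mu_star_def twist_def subst_def Let_def pair_def)

lemma pair_dual_smul [simp]: "pair (dual v) (smul k v) = 0" "pair (dual v) v = 0"
  "pair (dual v) (- v) = 0"
  by (simp_all add: pair_dual pair_linear)

text \<open>The \<open>n\<close>-th power of the mutation is the twist by
  \<open>- smul (int n) v\<close>, so lying in the image means that the inverse twist is
  Laurent.\<close>

lemma mu_star_funpow_image:
  assumes "v \<noteq> 0"
  shows "(mu_star \<omega> v ^^ n) ` laurent = {f. twist (dual v) (smul (int n) v) f \<in> laurent}"
proof -
  note d = dual_neq_0[OF assms]
  have pow: "(mu_star \<omega> v ^^ n) f = twist (dual v) (- smul (int n) v) f" for f
  proof (induction n)
    case 0
    show ?case by (simp add: smul_simps twist_0 d)
  next
    case (Suc n)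
    have "(mu_star \<omega> v ^^ Suc n) f = mu_star \<omega> v (twist (dual v) (- smul (int n) v) f)"
      by (simp add: Suc)
    also have "\<dots> = twist (dual v) (- v + - smul (int n) v) f"
      unfolding mu_star_eq_twist using d by (intro twist_twist) (simp_all add: pair_minus_right)
    also have "- v + - smul (int n) v = - smul (int (Suc n)) v"
      by (simp add: smul_simps)
    finally show ?case .
  qed
  show ?thesis
  proof (intro equalityI subsetI)
    fix f assume "f \<in> (mu_star \<omega> v ^^ n) ` laurent"
    then show "f \<in> {f. twist (dual v) (smul (int n) v) f \<in> laurent}"
      by (auto simp: pow twist_minus_cancel d)
  next
    fix f assume "f \<in> {f. twist (dual v) (smul (int n) v) f \<in> laurent}"
    moreover have "f = (mu_star \<omega> v ^^ n) (twist (dual v) (smul (int n) v) f)"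
      by (simp add: pow twist_minus_cancel d)
    ultimately show "f \<in> (mu_star \<omega> v ^^ n) ` laurent" by blast
  qed
qed

text \<open>The twist lemmas need a nonzero direction. As 0 does not occur in \<open>V\<close>, its
  multiplicity is 0 and it contributes only that \<open>f\<close> is Laurent.\<close>

lemma mem_upper_bound_iff:
  assumes "0 \<notin> set V"
  shows "f \<in> upper_bound \<omega> V \<longleftrightarrow> f \<in> laurent \<and>
    (\<forall>v. v \<noteq> 0 \<longrightarrow> twist (dual v) (smul (int (mult_fun V v)) v) f \<in> laurent)"
proof -
  have "f \<in> (mu_star \<omega> v ^^ mult_fun V v) ` laurent \<longleftrightarrow>
      (v \<noteq> 0 \<longrightarrow> twist (dual v) (smul (int (mult_fun V v)) v) f \<in> laurent)"
    if "f \<in> laurent" for v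
  proof (cases "v = 0")
    case True
    with assms have "mult_fun V v = 0" by (simp add: mult_fun_eq_0_iff)
    with True that show ?thesis by simp
  qed (simp add: mu_star_funpow_image)
  then show ?thesis
    unfolding upper_bound_def by blast
qed

text \<open>The tropical (piecewise linear) form of the mutation in direction \<open>v\<close>.\<close>

definition trop :: "int \<times> int \<Rightarrow> int \<times> int \<Rightarrow> int \<times> int" where
  "trop v u = u + smul (max 0 (\<omega> v u)) v"

lemma omega_trop: "\<omega> v (trop v u) = \<omega> v u"
  by (simp add: trop_def bilin_right scal_right)

text \<open>\<open>trop v\<close> preserves \<open>\<omega> v u\<close>, so the added multiple of
  \<open>v\<close> can be read off from the image.\<close>

lemma trop_inverse: "u = trop v u - smul (max 0 (\<omega> v (trop v u))) v"
  unfolding omega_trop by (simp add: trop_def)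

lemma trop_eq_iff: "trop v u = trop v u' \<longleftrightarrow> u = u'"
  using trop_inverse by metis

lemma trop_fixed: "trop v v = v" "trop v (- v) = - v"
  by (simp_all add: trop_def omega_minus smul_simps)

text \<open>The inverse of \<open>trop v\<close> commutes with positive scaling, so a factor
  \<open>k\<close> of \<open>trop v u\<close> would already divide \<open>u\<close>.\<close>

lemma primitive_trop:
  assumes "primitive u"
  shows "primitive (trop v u)"
  unfolding primitive_def
proof (intro conjI notI)
  assume "trop v u = 0"
  then have "u = 0"
    using trop_inverse[of u v] scal_right[of v 0 0] by (simp add: smul_simps)
  with assms show False by (simp add: primitive_def)
next
  assume "\<exists>k w. 1 < k \<and> trop v u = smul k w"
  then obtain k w where kw: "k > 1" "trop v u = smul k w" by blast
  have "max 0 (k * \<omega> v w) = k * max 0 (\<omega> v w)"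
    using kw(1) by (simp add: max_def mult_le_0_iff zero_le_mult_iff)
  then have "u = smul k (w + - smul (max 0 (\<omega> v w)) v)"
    using trop_inverse[of u v] unfolding kw(2) scal_right by (simp only: smul_simps) simp
  with assms kw(1) show False unfolding primitive_def by blast
qed

text \<open>Each direction is one transfer, along \<open>v\<close> or \<open>- v\<close>, with
  \<open>\<delta>\<close> chosen of positive degree: \<open>dual v\<close> with unchanged exponents
  if \<open>\<omega> v u\<close> is negative, when \<open>trop\<close> fixes \<open>u\<close>, and
  \<open>- dual v\<close> with sheared exponents if it is positive.\<close>

lemma twist_laurent_trop_iff:
  assumes "v \<noteq> 0" "u \<noteq> 0" "trop v u \<noteq> 0" "\<omega> v u \<noteq> 0" "m > 0"
    and f: "f \<in> laurent" "twist (dual v) v f \<in> laurent"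
  shows "twist (dual u) (smul m u) f \<in> laurent \<longleftrightarrow>
    twist (dual (trop v u)) (smul m (trop v u)) (twist (dual v) v f) \<in> laurent"
proof -
  define g where "g = twist (dual v) v f"
  define u' where "u' = trop v u"
  note nz = dual_neq_0[OF assms(1)] dual_neq_0[OF assms(2)] dual_neq_0[OF assms(3), folded u'_def]
  have fg: "f = twist (dual v) (- v) g"
    by (simp add: g_def twist_minus_cancel nz)
  have A: "1 + X (- dual v) \<noteq> 0"
    using nz(1) by (intro one_plus_X_neq_0) simp
  have flip: "(1 + X (dual v)) powi k = X (smul k (dual v)) * (1 + X (- dual v)) powi k" for k
  proof -
    have "1 + X (dual v) = X (dual v) * (1 + X (- dual v))"
      by (simp add: X_minus field_simps)
    then show ?thesis by (simp add: X_smul power_int_mult_distrib)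
  qed
  have \<sigma>: "twist (dual v) v (X p) = X p * (1 + X (dual v)) powi pair p v"
    "twist (dual v) (- v) (X p) = X p * (1 + X (dual v)) powi (- pair p v)" for p
    using nz by (simp_all add: twist_X pair_linear)
  \<comment> \<open>Passing from \<open>dual v\<close> to \<open>- dual v\<close> splits off a shear
    of the exponents, which serves as \<open>\<tau>\<close>.\<close>
  have \<sigma>': "twist (dual v) v (X p)
      = X (p + smul (pair p v) (dual v)) * (1 + X (- dual v)) powi pair p v"
    "twist (dual v) (- v) (X p)
      = X (p + smul (- pair p v) (dual v)) * (1 + X (- dual v)) powi (- pair p v)" for p
    by (simp_all only: \<sigma> flip X_add mult.assoc)
  note hom = K_hom_twist[OF nz(1) pair_dual_smul(2)] K_hom_twist[OF nz(1) pair_dual_smul(3)]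
  have "twist (dual u) (smul m u) f \<in> laurent \<longleftrightarrow> twist (dual u') (smul m u') g \<in> laurent"
  proof (cases "\<omega> v u < 0")
    case True
    then have u': "u' = u" by (simp add: u'_def trop_def smul_simps)
    have \<delta>: "pair (dual v) u > 0"
      using True skew[of u v] by (simp add: pair_dual)
    show ?thesis
    proof
      assume "twist (dual u) (smul m u) f \<in> laurent"
      then show "twist (dual u') (smul m u') g \<in> laurent"
        unfolding g_def u' using f nz \<delta> \<open>m > 0\<close>
        by (intro twist_laurent_transfer[OF _ _ _ _ _ hom(1) \<sigma>(1), of "dual u" u]) simp_all
    next
      assume "twist (dual u') (smul m u') g \<in> laurent"
      then show "twist (dual u) (smul m u) f \<in> laurent"
        unfolding fg u' using f nz \<delta> \<open>m > 0\<close>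
        by (intro twist_laurent_transfer[OF _ _ _ _ _ hom(2) \<sigma>(2), of "dual u" u])
          (simp_all add: g_def twist_minus_cancel)
    qed
  next
    case False
    define c where "c = \<omega> v u"
    have c: "c > 0" "\<omega> u v = - c" using False assms(4) skew[of u v] by (simp_all add: c_def)
    have u': "u' = u + smul c v" using c(1) by (simp add: u'_def trop_def c_def)
    have \<omega>u': "\<omega> v u' = c" "\<omega> u' v = - c"
      using c skew[of u' v] by (simp_all add: u' bilin_right scal_right c_def)
    have dual_u': "dual u' = dual u + smul c (dual v)"
      by (simp add: u' dual_add dual_smul)
    have \<delta>: "pair (- dual v) u > 0" "pair (- dual v) u' > 0"
      using c \<omega>u' by (simp_all add: pair_linear pair_dual)
    \<comment> \<open>The shears interchange the pairings with \<open>u\<close> and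
      \<open>u'\<close>, because \<open>\<omega> u v\<close> and \<open>\<omega> u' v\<close> both
      equal \<open>- c\<close>.\<close>
    have \<tau>: "pair (p + smul (pair p v) (dual v)) u' = pair p u"
      "pair (p + smul (- pair p v) (dual v)) u = pair p u'" for p
      using c \<omega>u' by (simp_all add: pair_linear pair_dual u' algebra_simps)
    show ?thesis
    proof
      assume "twist (dual u) (smul m u) f \<in> laurent"
      moreover have "dual u + smul (pair (dual u) v) (dual v) = dual u'"
        by (simp add: pair_dual dual_u' c_def)
      ultimately show "twist (dual u') (smul m u') g \<in> laurent"
        unfolding g_def using f nz \<delta> \<open>m > 0\<close> \<tau>(1)
        by (intro twist_laurent_transfer[OF _ _ _ _ _ hom(1) \<sigma>'(1), of "dual u" u]) simp_all
    next
      assume "twist (dual u') (smul m u') g \<in> laurent"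
      moreover have "dual u' + smul (- pair (dual u') v) (dual v) = dual u"
        by (simp only: pair_dual \<omega>u') (simp add: dual_u' smul_simps)
      ultimately show "twist (dual u) (smul m u) f \<in> laurent"
        unfolding fg using f nz \<delta> \<open>m > 0\<close> \<tau>(2)
        by (intro twist_laurent_transfer[OF _ _ _ _ _ hom(2) \<sigma>'(2), of "dual u'" u'])
          (simp_all add: g_def twist_minus_cancel)
    qed
  qed
  then show ?thesis by (simp add: g_def u'_def)
qed

section \<open>Mutation of collections and of upper bounds\<close>

lemma length_mutate: "length (mutate \<omega> V i) = length V"
  by (simp add: mutate_def)

lemma nth_mutate:
  "j < length V \<Longrightarrow> mutate \<omega> V i ! j = (if j = i then - (V ! i) else trop (V ! i) (V ! j))"
  by (simp add: mutate_def trop_def)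

lemma primitive_mutate:
  assumes "\<forall>v\<in>set V. primitive v"
  shows "\<forall>v\<in>set (mutate \<omega> V i). primitive v"
proof
  fix x assume "x \<in> set (mutate \<omega> V i)"
  then obtain j where j: "j < length V" "x = mutate \<omega> V i ! j"
    by (metis in_set_conv_nth length_mutate)
  then have "primitive (V ! j)"
    using assms by simp
  then show "primitive x"
    using j by (cases "j = i") (simp_all add: nth_mutate primitive_minus primitive_trop)
qed

lemma trop_eq_minus_iff: "trop v u = - v \<longleftrightarrow> u = - v"
  and trop_eq_self_iff: "trop v u = v \<longleftrightarrow> u = v"
  using trop_eq_iff[of v u "- v"] trop_eq_iff[of v u v] by (simp_all add: trop_fixed)

text \<open>The \<open>i\<close>-th entry moves from \<open>v\<close> to \<open>- v\<close>. All
  others go through \<open>trop v\<close>, which is injective and fixes \<open>v\<close> and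
  \<open>- v\<close>, so their multiplicities are carried along.\<close>

lemma mult_fun_mutate:
  assumes i: "i < length V" "V ! i = v" and "v \<noteq> 0"
  shows "mult_fun V v = Suc (mult_fun (mutate \<omega> V i) v)"
    and "mult_fun (mutate \<omega> V i) (- v) = Suc (mult_fun V (- v))"
    and "u \<noteq> v \<Longrightarrow> u \<noteq> - v \<Longrightarrow> mult_fun (mutate \<omega> V i) (trop v u) = mult_fun V u"
proof -
  have v: "- v \<noteq> v" "v \<noteq> - v"
    using \<open>v \<noteq> 0\<close> by (simp_all add: prod_eq_iff)
  have pos: "{j. j < length (mutate \<omega> V i) \<and> mutate \<omega> V i ! j = x}
      = {j. j < length V \<and> (if j = i then - v else trop v (V ! j)) = x}" for x
    using nth_mutate[of _ V i] i(2) by (simp add: length_mutate cong: conj_cong)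
  have "{j. j < length V \<and> V ! j = v}
      = insert i {j. j < length (mutate \<omega> V i) \<and> mutate \<omega> V i ! j = v}"
    unfolding pos using i v by (intro set_eqI) (simp add: trop_eq_self_iff)
  moreover have "i \<notin> {j. j < length (mutate \<omega> V i) \<and> mutate \<omega> V i ! j = v}"
    unfolding pos using v by simp
  ultimately show "mult_fun V v = Suc (mult_fun (mutate \<omega> V i) v)"
    by (simp add: mult_fun_eq_card)
  have "{j. j < length (mutate \<omega> V i) \<and> mutate \<omega> V i ! j = - v}
      = insert i {j. j < length V \<and> V ! j = - v}"
    unfolding pos using i v by (intro set_eqI) (simp add: trop_eq_minus_iff)
  moreover have "i \<notin> {j. j < length V \<and> V ! j = - v}"
    using i v by simp
  ultimately show "mult_fun (mutate \<omega> V i) (- v) = Suc (mult_fun V (- v))"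
    by (simp add: mult_fun_eq_card)
  assume u: "u \<noteq> v" "u \<noteq> - v"
  then have "- v \<noteq> trop v u" using trop_eq_minus_iff by metis
  then have "{j. j < length (mutate \<omega> V i) \<and> mutate \<omega> V i ! j = trop v u}
      = {j. j < length V \<and> V ! j = u}"
    unfolding pos using i u by (intro set_eqI) (simp add: trop_eq_iff)
  then show "mult_fun (mutate \<omega> V i) (trop v u) = mult_fun V u"
    by (simp add: mult_fun_eq_card)
qed

text \<open>As \<open>dual (- v) = - dual v\<close>, the two conditions differ only by the sign of
  the first argument of \<open>twist\<close>, which can be flipped either way.\<close>

lemma twist_dual_minus_iff:
  assumes "v \<noteq> 0" "f \<in> laurent"
  shows "twist (dual (- v)) (smul k (- v)) f \<in> laurent \<longleftrightarrow> twist (dual v) (smul (- k) v) f \<in> laurent"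
  using twist_laurent_flip[of "dual v" "smul (- k) v" f]
    twist_laurent_flip[of "- dual v" "smul (- k) v" f] dual_neq_0[OF assms(1)] assms(2)
  by (auto simp: dual_minus smul_simps pair_minus_right pair_minus_left)

text \<open>The conditions are matched vector by vector. At \<open>v\<close> and \<open>- v\<close>
  the multiplicity shifts by one, in step with the single twist between \<open>f\<close> and
  \<open>g\<close>; all other vectors correspond through \<open>trop v\<close>.\<close>

lemma mem_upper_bound_mutate_iff:
  assumes prim: "\<forall>v\<in>set V. primitive v" and i: "i < length V"
  shows "f \<in> upper_bound \<omega> V \<longleftrightarrow>
    twist (dual (V ! i)) (V ! i) f \<in> upper_bound \<omega> (mutate \<omega> V i)"
proof -
  define v where "v = V ! i"
  define V' where "V' = mutate \<omega> V i"
  define g where "g = twist (dual v) v f"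
  define a where "a = int (mult_fun V' v)"
  define b where "b = int (mult_fun V (- v))"
  have v: "primitive v" "v \<noteq> 0"
    using prim i by (auto simp: v_def primitive_def)
  note d = dual_neq_0[OF v(2)]
  have prim': "\<forall>v\<in>set V'. primitive v"
    unfolding V'_def using prim by (rule primitive_mutate)
  have nz: "0 \<notin> set V" "0 \<notin> set V'"
    using prim prim' by (auto simp: primitive_def)
  have mult: "int (mult_fun V v) = a + 1" "int (mult_fun V' (- v)) = b + 1"
    "u \<noteq> v \<Longrightarrow> u \<noteq> - v \<Longrightarrow> mult_fun V' (trop v u) = mult_fun V u" for u
    using mult_fun_mutate[OF i v_def[symmetric] v(2), folded V'_def] by (simp_all add: a_def b_def)
  have ab: "a \<ge> 0" "b \<ge> 0" by (simp_all add: a_def b_def)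
  have g_twist: "twist (dual v) (smul k v) g = twist (dual v) (smul (k + 1) v) f" for k
    using d by (simp add: g_def twist_twist smul_simps)
  have line: "twist (dual v) (smul (a + 1) v) f \<in> laurent \<longleftrightarrow> twist (dual v) (smul a v) g \<in> laurent"
    by (simp add: g_twist)
  have line': "twist (dual (- v)) (smul b (- v)) f \<in> laurent \<longleftrightarrow>
      twist (dual (- v)) (smul (b + 1) (- v)) g \<in> laurent" if "f \<in> laurent" "g \<in> laurent"
    unfolding twist_dual_minus_iff[OF v(2) that(1)] twist_dual_minus_iff[OF v(2) that(2)] g_twist
    by simp
  have other: "twist (dual u) (smul (int (mult_fun V u)) u) f \<in> laurent \<longleftrightarrow>
      twist (dual (trop v u)) (smul (int (mult_fun V' (trop v u))) (trop v u)) g \<in> laurent"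
    if "f \<in> laurent" "g \<in> laurent" "u \<in> set V" "u \<noteq> v" "u \<noteq> - v" for u
    unfolding mult(3)[OF that(4,5)] g_def
  proof (rule twist_laurent_trop_iff)
    have u: "primitive u" using prim that by blast
    then show "u \<noteq> 0" "trop v u \<noteq> 0"
      using primitive_trop[OF u, of v] by (simp_all add: primitive_def)
    show "\<omega> v u \<noteq> 0"
      using omega_eq_0_imp_parallel[OF u v(1)] that by blast
    show "0 < int (mult_fun V u)"
      using that(3) mult_fun_eq_0_iff[of V u] by simp
  qed (use that v in \<open>simp_all add: g_def\<close>)
  have set_V': "\<exists>u\<in>set V. u \<noteq> v \<and> u \<noteq> - v \<and> x = trop v u"
    if x: "x \<in> set V'" "x \<noteq> v" "x \<noteq> - v" for x
  proof -
    obtain j where j: "j < length V'" "V' ! j = x"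
      using x(1) unfolding in_set_conv_nth by blast
    from j(1) have "j < length V"
      by (simp only: V'_def length_mutate)
    then have "x = (if j = i then - v else trop v (V ! j))"
      using nth_mutate[of j V i] j(2) by (simp only: V'_def v_def)
    with x(3) have x_eq: "x = trop v (V ! j)"
      by presburger
    then have "V ! j \<noteq> v" "V ! j \<noteq> - v"
      using x(2,3) trop_fixed by metis+
    with x_eq \<open>j < length V\<close> show ?thesis
      using nth_mem by blast
  qed
  have trivial: "twist (dual x) (smul (int (mult_fun W x)) x) h \<in> laurent"
    if "h \<in> laurent" "x \<noteq> 0" "x \<notin> set W" for x h W
    using that dual_neq_0[OF that(2)] mult_fun_eq_0_iff[of W x] by (simp add: smul_simps twist_0)
  note ub = mem_upper_bound_iff[OF nz(1), of f] mem_upper_bound_iff[OF nz(2), of g]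
  have "f \<in> upper_bound \<omega> V \<longleftrightarrow> g \<in> upper_bound \<omega> V'"
  proof
    assume "f \<in> upper_bound \<omega> V"
    then have f: "f \<in> laurent"
        "\<And>x. x \<noteq> 0 \<Longrightarrow> twist (dual x) (smul (int (mult_fun V x)) x) f \<in> laurent"
      unfolding ub by blast+
    \<comment> \<open>As \<open>v\<close> occurs \<open>a + 1\<close> times in \<open>V\<close>,
      convexity brings the corresponding twist down to the single one, which is
      \<open>g\<close>.\<close>
    have "g \<in> laurent"
      unfolding g_def
      by (rule twist_laurent_convex[of _ _ "a + 1"])
        (use f(1) f(2)[OF v(2)] ab d in \<open>simp_all add: mult\<close>)
    moreover have "twist (dual x) (smul (int (mult_fun V' x)) x) g \<in> laurent" if "x \<noteq> 0" for x
    proof -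
      consider "x = v" | "x = - v" | "x \<notin> set V'" | "x \<in> set V'" "x \<noteq> v" "x \<noteq> - v" by blast
      then show ?thesis
      proof cases
        case 1
        then show ?thesis using f(2)[OF v(2)] line by (simp add: mult a_def)
      next
        case 2
        then show ?thesis
          using f(2)[of "- v"] v(2) line'[OF f(1) \<open>g \<in> laurent\<close>] by (simp add: mult b_def)
      next
        case 3
        then show ?thesis using trivial \<open>g \<in> laurent\<close> that by blast
      next
        case 4
        then obtain u where u: "u \<in> set V" "u \<noteq> v" "u \<noteq> - v" "x = trop v u"
          using set_V' by blast
        then have "u \<noteq> 0" using nz by blast
        then show ?thesis
          using other[OF f(1) \<open>g \<in> laurent\<close> u(1-3)] f(2) unfolding u(4) by blast
      qed
    qed
    ultimately show "g \<in> upper_bound \<omega> V'"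
      unfolding ub by blast
  next
    assume "g \<in> upper_bound \<omega> V'"
    then have g: "g \<in> laurent"
        "\<And>x. x \<noteq> 0 \<Longrightarrow> twist (dual x) (smul (int (mult_fun V' x)) x) g \<in> laurent"
      unfolding ub by blast+
    \<comment> \<open>Here \<open>- v\<close> occurs \<open>b + 1\<close> times in
      \<open>V'\<close>. Convexity yields the single twist along \<open>- v\<close>, and flipping
      its direction to \<open>dual v\<close> recovers \<open>f\<close>.\<close>
    have "twist (dual (- v)) (- v) g \<in> laurent"
      by (rule twist_laurent_convex[of _ _ "b + 1"])
        (use g(1) g(2)[of "- v"] v(2) ab d in \<open>simp_all add: mult dual_minus pair_minus_left\<close>)
    then have "twist (dual v) (smul (- 1) v) g \<in> laurent"
      using twist_dual_minus_iff[OF v(2) g(1), of 1] by (simp add: smul_simps)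
    then have "f \<in> laurent"
      using d unfolding g_twist by (simp add: smul_simps twist_0)
    moreover have "twist (dual x) (smul (int (mult_fun V x)) x) f \<in> laurent" if "x \<noteq> 0" for x
    proof -
      consider "x = v" | "x = - v" | "x \<notin> set V" | "x \<in> set V" "x \<noteq> v" "x \<noteq> - v" by blast
      then show ?thesis
      proof cases
        case 1
        then show ?thesis using g(2)[OF v(2)] line by (simp add: mult a_def)
      next
        case 2
        then show ?thesis
          using g(2)[of "- v"] v(2) line'[OF \<open>f \<in> laurent\<close> g(1)] by (simp add: mult b_def)
      next
        case 3
        then show ?thesis using trivial \<open>f \<in> laurent\<close> that by blast
      next
        case 4
        have "primitive x" using prim 4(1) by blast
        then have "trop v x \<noteq> 0" using primitive_trop by (auto simp: primitive_def)
        then show ?thesis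
          using other[OF \<open>f \<in> laurent\<close> g(1) 4] g(2) by blast
      qed
    qed
    ultimately show "f \<in> upper_bound \<omega> V"
      unfolding ub by blast
  qed
  then show ?thesis by (simp add: g_def v_def V'_def)
qed

text \<open>\<open>mu_star\<close> in direction \<open>V ! i\<close> is inverse to the twist in the
  membership criterion, which is thus this equality read pointwise.\<close>

lemma upper_bound_mutate:
  assumes prim: "\<forall>v\<in>set V. primitive v" and i: "i < length V"
  shows "upper_bound \<omega> V = mu_star \<omega> (V ! i) ` upper_bound \<omega> (mutate \<omega> V i)"
proof -
  have "V ! i \<noteq> 0"
    using assms by (auto simp: primitive_def)
  note cancel = twist_minus_cancel[OF dual_neq_0[OF this] pair_dual_smul(2)]
  note iff = mem_upper_bound_mutate_iff[OF prim i]
  show ?thesis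
    unfolding mu_star_eq_twist
  proof (intro equalityI subsetI)
    fix f assume "f \<in> upper_bound \<omega> V"
    then show "f \<in> twist (dual (V ! i)) (- (V ! i)) ` upper_bound \<omega> (mutate \<omega> V i)"
      using iff cancel(1)[of f] by (metis imageI)
  next
    fix f assume "f \<in> twist (dual (V ! i)) (- (V ! i)) ` upper_bound \<omega> (mutate \<omega> V i)"
    then show "f \<in> upper_bound \<omega> V"
      using iff cancel(2) by auto
  qed
qed

text \<open>Mutation preserves primitivity and length, so the remaining directions stay admissible
  in the induction.\<close>

lemma upper_bound_mutate_seq:
  assumes "\<forall>v\<in>set V. primitive v" "set is \<subseteq> {..<length V}"
  shows "upper_bound \<omega> V = mu_seq \<omega> V is ` upper_bound \<omega> (mutate_seq \<omega> V is)"
  using assms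
proof (induction "is" arbitrary: V)
  case (Cons i "is")
  have "upper_bound \<omega> (mutate \<omega> V i)
      = mu_seq \<omega> (mutate \<omega> V i) is ` upper_bound \<omega> (mutate_seq \<omega> (mutate \<omega> V i) is)"
    using Cons.prems by (intro Cons.IH primitive_mutate) (simp_all add: length_mutate)
  then show ?case
    using upper_bound_mutate[of V i] Cons.prems by (simp add: image_comp)
qed simp

end

theorem theorem3p1:
  fixes \<omega> :: "int \<times> int \<Rightarrow> int \<times> int \<Rightarrow> int" and V :: "(int \<times> int) list"
  assumes bilin_left: "\<And>u u' v. \<omega> (u + u') v = \<omega> u v + \<omega> u' v"
      and bilin_right: "\<And>u v v'. \<omega> u (v + v') = \<omega> u v + \<omega> u v'"
      and scal_left: "\<And>k u v. \<omega> (smul k u) v = k * \<omega> u v"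
      and scal_right: "\<And>k u v. \<omega> u (smul k v) = k * \<omega> u v"
      and skew: "\<And>u v. \<omega> u v = - \<omega> v u"
      and nondeg: "\<And>u. (\<forall>v. \<omega> u v = 0) \<Longrightarrow> u = 0"
      and prim: "\<forall>v\<in>set V. primitive v"
  shows "(\<forall>i < length V. upper_bound \<omega> V = mu_star \<omega> (V ! i) ` upper_bound \<omega> (mutate \<omega> V i))
       \<and> (\<forall>is. set is \<subseteq> {..<length V} \<longrightarrow>
             upper_bound \<omega> V = mu_seq \<omega> V is ` upper_bound \<omega> (mutate_seq \<omega> V is))"
proof -
  interpret nondegenerate_skew_form \<omega>
    using bilin_left bilin_right scal_left scal_right skew nondeg by (rule nondegenerate_skew_form.intro)
  show ?thesis
    using upper_bound_mutate[OF prim] upper_bound_mutate_seq[OF prim] by blast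
qed

end
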